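(* Let $A,B_\Delta,B_d,C_\Delta,E_\Delta,E_d,C_y,D_\Delta,D_d,C_z$ be given real matrices of compatible sizes, let $\gamma>0$, and let $\rho\in\mathbb{R}^{N_y}$ be a vector with positive entries. Consider the uncertain plant, observer and error system described in the context, and the sparse $\mathcal{H}_\infty$-optimal robust observer design problem: determine optimal $L\in\mathbb{R}^{N_x\times N_y}$ and $\beta\in\mathbb{R}^{N_y}$, $\beta>0$, that minimize $\|\beta\|_{1,\rho}=\rho^T|\beta|$ such that $\|\mathcal{G}_{\tilde w\varepsilon}\|_\infty\le\gamma$ and $\|\mathcal{G}_{\tilde wz_\Delta}\|_\infty\le1$ for all admissible $\Delta$. The optimal observer gain $L$ and sensor precision $\beta$ for this design problem are determined by solving the following optimization problem in the variables $X_1=X_1^T\in\mathbb{R}^{N_x\times N_x}$, $X_2=X_2^T\in\mathbb{R}^{N_x\times N_x}$, $Y\in\mathbb{R}^{N_x\times N_y}$, $\beta\in\mathbb{R}^{N_y}$, and if the problem is feasible then the gain is recovered as $L=X_2^{-1}Y$: $$\min_{X_1>0,\;X_2>0,\;Y,\;\beta>0}\ \|\beta\|_{1,\rho}\quad\text{such that}$$ $$\begin{bmatrix}Z_{11}&Z_{12}&Z_{13}\\\ast&E_\Delta^TE_\Delta-I&E_\Delta^TE_d\\\ast&\ast&E_d^TE_d-I\end{bmatrix}<0,\qquad \begin{bmatrix}W_{11}&W_{12}&W_{13}&Y\\\ast&-\gamma^2I&0&0\\\ast&\ast&-\gamma^2I&0\\\ast&\ast&\ast&-\gamma^2\,\mathrm{diag}(\beta)\end{bmatrix}<0,$$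 where $$Z_{11}=\mathrm{sym}(X_1A)+C_\Delta^TC_\Delta,\qquad Z_{12}=X_1B_\Delta+C_\Delta^TE_\Delta,\qquad Z_{13}=X_1B_d+C_\Delta^TE_d,$$ $$W_{11}=\mathrm{sym}(X_2A+YC_y)+C_z^TC_z,\qquad W_{12}=X_2B_\Delta+YD_\Delta,\qquad W_{13}=X_2B_d+YD_d.$$
   Context: Notation: $\mathrm{sym}(X):=X+X^T$; $X>0$ ($X<0$) means symmetric positive (negative) definite; $\ast$ denotes blocks determined by symmetry; $\mathrm{diag}(\beta)$ is the diagonal matrix with diagonal $\beta$, and $\mathrm{diag}$ of matrices is block diagonal; vector inequalities and absolute values are elementwise; $I$ and $0$ are identity and zero matrices of suitable size. For a transfer function matrix $\mathcal{G}(s)$, $\|\mathcal{G}\|_\infty$ is the $\mathcal{H}_\infty$ norm (supremum of the largest singular value on the imaginary axis, for stable $\mathcal{G}$; the statement $\|\mathcal{G}\|_\infty\le\gamma$ includes stability of $\mathcal{G}$). Plant in linear fractional form, with $\tilde w=[w_\Delta^T,d^T,n^T]^T$: $$\dot x=Ax+[B_\Delta\;\;B_d\;\;0]\tilde w,\quad z_\Delta=C_\Delta x+[E_\Delta\;\;E_d\;\;0]\tilde w,\quad y=C_yx+[D_\Delta\;\;D_d\;\;S_n]\tilde w,\quad z=C_zx,\quad w_\Delta=\Delta z_\Delta,$$ with state $x\in\mathbb{R}^{N_x}$, measurement $y\in\mathbb{R}^{N_y}$, output of interest $z\in\mathbb{R}^{N_z}$, process noise $d\in\mathbb{R}^{N_d}$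 and sensor noise $n\in\mathbb{R}^{N_y}$ (both $\mathcal{L}_2$-norm bounded signals, with the components of $n$ normalized so that $\|n_i\|_2^2=1$), and fictitious input $w_\Delta$ and output $z_\Delta$ of the plant due to the uncertainty block $\Delta$, which is admissible if $\|\Delta\|_\infty\le1$. $S_n$ is an unknown diagonal matrix with positive diagonal entries, to be determined, related to the precision vector $\beta>0$ by $\mathrm{diag}(\beta)=(S_nS_n)^{-1}$; $\beta_i$ is the precision of the $i$-th sensor. Observer: $\dot{\hat x}=(A+LC_y)\hat x-Ly$, $\hat z=C_z\hat x$, with gain $L\in\mathbb{R}^{N_x\times N_y}$. Errors: $e=x-\hat x$, $\varepsilon=z-\hat z$. The error system is $$\dot e=(A+LC_y)e+\tilde B\tilde S\tilde w,\qquad \varepsilon=C_ze,\qquad \tilde B=[B_\Delta\;\;B_d\;\;0]+L[D_\Delta\;\;D_d\;\;I],\qquad \tilde S=\mathrm{diag}(I,I,S_n).$$ $\mathcal{G}_{\tilde w\varepsilon}(s)$ and $\mathcal{G}_{\tilde wz_\Delta}(s)$ are the transfer function matrices from $\tilde w$ (the whole vector, including $w_\Delta$, being treated as the input) to $\varepsilon$ and to $z_\Delta$: $$\mathcal{G}_{\tilde w\varepsilon}(s)=C_z(sI-A-LC_y)^{-1}\tilde B\tilde S,\qquad \mathcal{G}_{\tilde wz_\Delta}(s)=C_\Delta(sI-A)^{-1}[B_\Delta\;\;B_d\;\;0]+[E_\Delta\;\;E_d\;\;0].$$ *)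

theory Defs
  imports "HOL-Analysis.Analysis"
begin

section \<open>Matrices\<close>

definition hcat :: "'a^'m^'r \<Rightarrow> 'a^'n^'r \<Rightarrow> 'a^('m + 'n)^'r"  (infixr "|||" 64) where
  "M ||| N = (\<chi> i j. case j of Inl a \<Rightarrow> M $ i $ a | Inr b \<Rightarrow> N $ i $ b)"

definition vcat :: "'a^'n^'r \<Rightarrow> 'a^'n^'s \<Rightarrow> 'a^'n^('r + 's)"  (infixr "\<sslash>" 63) where
  "M \<sslash> N = (\<chi> i. case i of Inl a \<Rightarrow> M $ a | Inr b \<Rightarrow> N $ b)"

definition diag :: "'a::zero^'n \<Rightarrow> 'a^'n^'n" where
  "diag v = (\<chi> i j. if i = j then v $ i else 0)"

definition block_diag :: "'a::zero^'m^'r \<Rightarrow> 'a^'n^'s \<Rightarrow> 'a^('m + 'n)^('r + 's)" where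
  "block_diag M N = (M ||| 0) \<sslash> (0 ||| N)"

definition symmetrize :: "real^'n^'n \<Rightarrow> real^'n^'n" where
  "symmetrize M = M + transpose M"

definition pos_def :: "real^'n^'n \<Rightarrow> bool" where
  "pos_def M \<longleftrightarrow> transpose M = M \<and> (\<forall>v. v \<noteq> 0 \<longrightarrow> 0 < v \<bullet> (M *v v))"

definition neg_def :: "real^'n^'n \<Rightarrow> bool" where
  "neg_def M \<longleftrightarrow> pos_def (- M)"

abbreviation cmat :: "real^'n^'m \<Rightarrow> complex^'n^'m" where
  "cmat \<equiv> map_matrix complex_of_real"

definition eigenvalue :: "complex^'n^'n \<Rightarrow> complex \<Rightarrow> bool" where
  "eigenvalue M l \<longleftrightarrow> (\<exists>v. v \<noteq> 0 \<and> M *v v = l *s v)"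

definition conj_transpose :: "complex^'n^'m \<Rightarrow> complex^'m^'n" where
  "conj_transpose M = transpose (map_matrix cnj M)"

text \<open>
  For a wide matrix the set below may contain additional zeros, which do not affect
  its maximum.
\<close>

definition singular_values :: "complex^'n^'m \<Rightarrow> real set" where
  "singular_values M =
     {\<sigma>. 0 \<le> \<sigma> \<and> eigenvalue (conj_transpose M ** M) (complex_of_real (\<sigma>\<^sup>2))}"

definition max_singular_value :: "complex^'n^'m \<Rightarrow> real" where
  "max_singular_value M = Sup (singular_values M)"


section \<open>Transfer functions and the H-infinity norm\<close>

definition hurwitz :: "real^'n^'n \<Rightarrow> bool" where
  "hurwitz F \<longleftrightarrow> (\<forall>l. eigenvalue (cmat F) l \<longrightarrow> Re l < 0)"

definition transfer ::
  "real^'n^'n \<Rightarrow> real^'m^'n \<Rightarrow> real^'n^'p \<Rightarrow> real^'m^'p \<Rightarrow> complex \<Rightarrow> complex^'m^'p" where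
  "transfer F B C D s = cmat C ** matrix_inv (mat s - cmat F) ** cmat B + cmat D"

text \<open>The value below is the H-infinity norm only when the function is stable.\<close>

definition hinf_norm :: "(complex \<Rightarrow> complex^'m^'p) \<Rightarrow> ereal" where
  "hinf_norm G = (SUP \<omega>::real. ereal (max_singular_value (G (\<i> * complex_of_real \<omega>))))"

text \<open>
  A norm bound on a system given by a realization includes stability of that realization.
  The comparison \<open>R\<close> is either \<open>(\<le>)\<close> or \<open>(<)\<close>.
\<close>

definition hinf_bound ::
  "(ereal \<Rightarrow> ereal \<Rightarrow> bool) \<Rightarrow> real^'n^'n \<Rightarrow> real^'m^'n \<Rightarrow> real^'n^'p \<Rightarrow> real^'m^'p \<Rightarrow> real \<Rightarrow> bool"
where
  "hinf_bound R F B C D g \<longleftrightarrow> hurwitz F \<and> R (hinf_norm (transfer F B C D)) (ereal g)"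

definition admissible :: "(complex \<Rightarrow> complex^'q^'w) \<Rightarrow> bool" where
  "admissible \<Delta> \<longleftrightarrow>
     (\<forall>i j. (\<lambda>s. \<Delta> s $ i $ j) analytic_on {s. 0 \<le> Re s}) \<and>
     bounded (\<Delta> ` {s. 0 \<le> Re s}) \<and> hinf_norm \<Delta> \<le> 1"


section \<open>Robust observer design\<close>

text \<open>
  Index types: \<open>'x\<close> state, \<open>'w\<close> and \<open>'q\<close> input and output of the uncertainty channel,
  \<open>'d\<close> process noise, \<open>'y\<close> measurements (hence sensor noise), \<open>'z\<close> output of interest.
  The exogenous input \<open>(w\<^sub>\<Delta>, d, n)\<close> has index type \<open>'w + 'd + 'y\<close>.
\<close>

record ('x::finite, 'w::finite, 'q::finite, 'd::finite, 'y::finite, 'z::finite) plant =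
  A_mat :: "real^'x^'x"
  B_Delta :: "real^'w^'x"
  B_d :: "real^'d^'x"
  C_Delta :: "real^'x^'q"
  E_Delta :: "real^'w^'q"
  E_d :: "real^'d^'q"
  C_y :: "real^'x^'y"
  D_Delta :: "real^'w^'y"
  D_d :: "real^'d^'y"
  C_z :: "real^'x^'z"

text \<open>The positive diagonal noise scaling determined by a precision vector.\<close>

definition noise_scaling :: "real^'y \<Rightarrow> real^'y^'y" where
  "noise_scaling \<beta> = diag (\<chi> i. 1 / sqrt (\<beta> $ i))"

lemma diag_mult: "diag u ** diag v = diag (\<chi> i. (u $ i * v $ i :: real))"
proof -
  have "(\<Sum>k\<in>UNIV. (if i = k then u $ i else 0) * (if k = j then v $ k else 0)) =
      (\<Sum>k\<in>UNIV. if k = i then u $ i * (if i = j then v $ i else 0) else 0)" for i j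
    by (intro sum.cong) auto
  then show ?thesis
    by (simp add: diag_def matrix_matrix_mult_def vec_eq_iff)
qed

lemma diag_one: "diag (\<chi> i. (1 :: real)) = mat 1"
  by (simp add: diag_def mat_def vec_eq_iff)

lemma noise_scaling_precision:
  assumes "\<forall>i. 0 < \<beta> $ i"
  shows "diag \<beta> = matrix_inv (noise_scaling \<beta> ** noise_scaling \<beta>)"
proof -
  let ?M = "noise_scaling \<beta> ** noise_scaling \<beta>"
  have eq: "?M = diag (\<chi> i. 1 / \<beta> $ i)"
    using assms by (simp add: noise_scaling_def diag_mult less_imp_le)
  have nz: "\<beta> $ i \<noteq> 0" for i
    using assms by (metis less_irrefl)
  have l: "diag \<beta> ** ?M = mat 1" and r: "?M ** diag \<beta> = mat 1"
    by (simp_all add: eq diag_mult nz diag_one)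
  then have "\<exists>N. ?M ** N = mat 1 \<and> N ** ?M = mat 1"
    by blast
  then have "?M ** matrix_inv ?M = mat 1"
    unfolding matrix_inv_def by (rule someI2_ex) blast
  then show ?thesis
    using matrix_mul_assoc[of "diag \<beta>" ?M "matrix_inv ?M"] l
    by (simp only: matrix_mul_lid matrix_mul_rid)
qed

definition error_A ::
  "('x::finite, 'w::finite, 'q::finite, 'd::finite, 'y::finite, 'z::finite) plant
     \<Rightarrow> real^'y^'x \<Rightarrow> real^'x^'x"
where
  "error_A P L = A_mat P + L ** C_y P"

definition error_B ::
  "('x::finite, 'w::finite, 'q::finite, 'd::finite, 'y::finite, 'z::finite) plant
     \<Rightarrow> real^'y^'x \<Rightarrow> real^('w + 'd + 'y)^'x" where
  "error_B P L = (B_Delta P ||| B_d P ||| 0) + L ** (D_Delta P ||| D_d P ||| mat 1)"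

definition input_scaling :: "real^'y \<Rightarrow> real^('w::finite + 'd::finite + 'y)^('w + 'd + 'y)" where
  "input_scaling \<beta> = block_diag (mat 1) (block_diag (mat 1) (noise_scaling \<beta>))"

text \<open>
  Both transfer functions take \<open>w\<^sub>\<Delta>\<close> as an exogenous input, so the norm constraints
  do not mention \<open>\<Delta>\<close>.
\<close>

definition design_feasible ::
  "(ereal \<Rightarrow> ereal \<Rightarrow> bool) \<Rightarrow> ('x::finite, 'w::finite, 'q::finite, 'd::finite, 'y::finite, 'z::finite) plant
     \<Rightarrow> real \<Rightarrow> (real^'y^'x) \<times> (real^'y) \<Rightarrow> bool" where
  "design_feasible R P \<gamma> = (\<lambda>(L, \<beta>).
     (\<forall>i. 0 < \<beta> $ i) \<and>
     (\<forall>\<Delta> :: complex \<Rightarrow> complex^'q^'w. admissible \<Delta> \<longrightarrow>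
        hinf_bound R (error_A P L) (error_B P L ** input_scaling \<beta>) (C_z P) 0 \<gamma> \<and>
        hinf_bound R (A_mat P) (B_Delta P ||| B_d P ||| (0 :: real^'y^'x))
          (C_Delta P) (E_Delta P ||| E_d P ||| (0 :: real^'y^'q)) 1))"

definition weighted_norm1 :: "real^'y \<Rightarrow> real^'y \<Rightarrow> real" where
  "weighted_norm1 \<rho> \<beta> = \<rho> \<bullet> (\<chi> i. \<bar>\<beta> $ i\<bar>)"

definition LMI_Z ::
  "('x::finite, 'w::finite, 'q::finite, 'd::finite, 'y::finite, 'z::finite) plant
     \<Rightarrow> real^'x^'x \<Rightarrow> real^('x + 'w + 'd)^('x + 'w + 'd)"
where
  "LMI_Z P X =
    (let A = A_mat P; Bw = B_Delta P; Bd = B_d P; C = C_Delta P; Ew = E_Delta P; Ed = E_d P;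
         Z11 = symmetrize (X ** A) + transpose C ** C;
         Z12 = X ** Bw + transpose C ** Ew;
         Z13 = X ** Bd + transpose C ** Ed
     in (Z11           ||| Z12                         ||| Z13) \<sslash>
        (transpose Z12 ||| transpose Ew ** Ew - mat 1  ||| transpose Ew ** Ed) \<sslash>
        (transpose Z13 ||| transpose (transpose Ew ** Ed) ||| transpose Ed ** Ed - mat 1))"

definition LMI_W ::
  "('x::finite, 'w::finite, 'q::finite, 'd::finite, 'y::finite, 'z::finite) plant
     \<Rightarrow> real \<Rightarrow> real^'x^'x \<Rightarrow> real^'y^'x \<Rightarrow> real^'y
     \<Rightarrow> real^('x + 'w + 'd + 'y)^('x + 'w + 'd + 'y)" where
  "LMI_W P \<gamma> X Y \<beta> =
    (let W11 = symmetrize (X ** A_mat P + Y ** C_y P) + transpose (C_z P) ** C_z P;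
         W12 = X ** B_Delta P + Y ** D_Delta P;
         W13 = X ** B_d P + Y ** D_d P
     in (W11           ||| W12              ||| W13              ||| Y) \<sslash>
        (transpose W12 ||| mat (- (\<gamma>\<^sup>2))     ||| 0                ||| 0) \<sslash>
        (transpose W13 ||| 0                ||| mat (- (\<gamma>\<^sup>2))     ||| 0) \<sslash>
        (transpose Y   ||| 0                ||| 0                ||| - (\<gamma>\<^sup>2 *\<^sub>R diag \<beta>)))"

definition lmi_feasible ::
  "('x::finite, 'w::finite, 'q::finite, 'd::finite, 'y::finite, 'z::finite) plant
     \<Rightarrow> real
     \<Rightarrow> (real^'x^'x) \<times> (real^'x^'x) \<times> (real^'y^'x) \<times> (real^'y) \<Rightarrow> bool" where
  "lmi_feasible P \<gamma> = (\<lambda>(X1, X2, Y, \<beta>).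
     pos_def X1 \<and> pos_def X2 \<and> (\<forall>i. 0 < \<beta> $ i) \<and>
     neg_def (LMI_Z P X1) \<and> neg_def (LMI_W P \<gamma> X2 Y \<beta>))"

definition design_cost :: "real^'y \<Rightarrow> (real^'y^'x) \<times> (real^'y) \<Rightarrow> real" where
  "design_cost \<rho> = (\<lambda>(L, \<beta>). weighted_norm1 \<rho> \<beta>)"

definition lmi_cost ::
  "real^'y \<Rightarrow> (real^'x^'x) \<times> (real^'x^'x) \<times> (real^'y^'x) \<times> (real^'y) \<Rightarrow> real" where
  "lmi_cost \<rho> = (\<lambda>(X1, X2, Y, \<beta>). weighted_norm1 \<rho> \<beta>)"

text \<open>
  Minimizers up to a tolerance. Tolerance 0 gives exact minimizers, but a feasible
  matrix inequality problem has none: its constraints are open and its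
  cost strictly increases in every component of \<open>\<beta>\<close>.
\<close>

definition minimizer_upto :: "real \<Rightarrow> ('a \<Rightarrow> real) \<Rightarrow> ('a \<Rightarrow> bool) \<Rightarrow> 'a \<Rightarrow> bool" where
  "minimizer_upto e f P x \<longleftrightarrow> P x \<and> (\<forall>y. P y \<longrightarrow> f x \<le> f y + e)"

end

theory Submission
  imports Defs
begin

text \<open>
  Both norm constraints are instances of the strict bounded real lemma: for \<open>g > 0\<close>, \<open>F\<close> is Hurwitz
  and \<open>C (s I - F)\<^sup>-\<^sup>1 B + D\<close> has H-infinity norm below \<open>g\<close> iff some positive definite \<open>X\<close> makes
  \<open>2 x \<bullet> X (F x + B w) + |C x + D w|\<^sup>2 - g\<^sup>2 |w|\<^sup>2\<close> negative for \<open>(x, w) \<noteq> 0\<close>. The matrix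
  inequalities are this form written in blocks, after substituting \<open>Y = X\<^sub>2 L\<close> and rescaling the
  noise by \<open>S\<^sub>n\<close>.

  A symmetric \<open>X\<close> is found by Rantzer's argument. If there is none, a hyperplane separation yields a
  nonzero positive semidefinite \<open>Z\<close> on pairs \<open>(x, w)\<close> such that the \<open>x\<close>-block of \<open>[F B] Z\<close> is skew
  and the form has nonnegative trace against \<open>Z\<close>. Splitting off eigenvectors of the skew block
  writes \<open>Z\<close> as a sum of harmonic responses \<open>i \<omega> x = F x + B w\<close>, on each of which the form is
  negative, a contradiction.

  The infima agree although the nonstrict norm bound is weaker than the matrix inequality: the
  latter is affine in \<open>(X\<^sub>2, Y, \<beta>)\<close>, so a small convex combination of a norm-feasible design with a
  strictly feasible point is strictly feasible at nearly the same cost.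
\<close>

section \<open>Generalized eigenvectors of semidefinite forms\<close>

definition selfadjoint :: "('a::euclidean_space \<Rightarrow> 'a) \<Rightarrow> bool" where
  "selfadjoint M \<longleftrightarrow> linear M \<and> (\<forall>u v. M u \<bullet> v = u \<bullet> M v)"

definition psd :: "('a::euclidean_space \<Rightarrow> 'a) \<Rightarrow> bool" where
  "psd M \<longleftrightarrow> selfadjoint M \<and> (\<forall>u. 0 \<le> u \<bullet> M u)"

text \<open>Along \<open>u + t M u\<close> the form is \<open>2 t |M u|^2\<close> plus a term of
  order \<open>t^2\<close>, so small negative \<open>t\<close> would make it negative unless
  \<open>M u\<close> vanishes.\<close>

lemma psd_form_zero:
  assumes M: "psd M" and u: "u \<bullet> M u = 0"
  shows "M u = 0"
proof (rule ccontr)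
  assume nz: "M u \<noteq> 0"
  have lin: "linear M" and sa: "\<And>u v. M u \<bullet> v = u \<bullet> M v" and pos: "\<And>u. 0 \<le> u \<bullet> M u"
    using M by (auto simp: psd_def selfadjoint_def)
  define a where "a = M u \<bullet> M u"
  define b where "b = M u \<bullet> M (M u)"
  have a: "a > 0" and b: "b \<ge> 0"
    using nz pos by (auto simp: a_def b_def)
  \<comment> \<open>The \<open>+ 1\<close> keeps the denominator positive when \<open>b = 0\<close>,
    and \<open>2 t a + t^2 b\<close> is still negative.\<close>
  define t where "t = - a / (b + 1)"
  have "0 \<le> (u + t *\<^sub>R M u) \<bullet> M (u + t *\<^sub>R M u)"
    by (rule pos)
  also have "\<dots> = 2 * t * a + t\<^sup>2 * b"
    using u sa[of u "M u"]
    by (simp add: linear_add[OF lin] linear_cmul[OF lin] inner_add_left inner_add_right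
        a_def b_def power2_eq_square algebra_simps)
  also have "\<dots> = a\<^sup>2 / (b + 1)\<^sup>2 * (- 2 * (b + 1) + b)"
    using b by (simp add: t_def field_simps power2_eq_square add_nonneg_eq_0_iff)
  also have "\<dots> < 0"
    using a b by (intro mult_pos_neg) auto
  finally show False by simp
qed

text \<open>Maximizing the ratio of the two forms on the unit sphere of the range of \<open>M\<close>.\<close>

lemma generalized_eigenvector:
  fixes M H :: "'a::euclidean_space \<Rightarrow> 'a"
  assumes M: "psd M" and H: "selfadjoint H"
    and ker: "\<And>u. M u = 0 \<Longrightarrow> H u = 0" and nz: "M u0 \<noteq> 0"
  obtains c u where "u \<bullet> M u = 1" "H u = c *\<^sub>R M u" "\<And>v. v \<bullet> H v \<le> c * (v \<bullet> M v)"
proof -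
  have lin: "linear M" and sa: "\<And>u v. M u \<bullet> v = u \<bullet> M v" and pos: "\<And>u. 0 \<le> u \<bullet> M u"
    using M by (auto simp: psd_def selfadjoint_def)
  have linH: "linear H" and saH: "\<And>u v. H u \<bullet> v = u \<bullet> H v"
    using H by (auto simp: selfadjoint_def)
  have sub: "subspace (range M)"
    by (simp add: lin linear_subspace_image)
  \<comment> \<open>The kernel of a selfadjoint map is orthogonal to its range, so the denominator
    of the quotient \<open>r\<close> cannot vanish on \<open>S\<close>.\<close>
  have Mpos: "0 < u \<bullet> M u" if "u \<in> range M" "u \<noteq> 0" for u
  proof -
    have "M u \<noteq> 0"
    proof
      assume "M u = 0"
      from \<open>u \<in> range M\<close> obtain v where "u = M v" by auto
      then have "u \<bullet> u = v \<bullet> M u"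
        using sa[of v u] by simp
      with \<open>M u = 0\<close> \<open>u \<noteq> 0\<close> show False by simp
    qed
    then show ?thesis
      using psd_form_zero[OF M, of u] pos[of u] by fastforce
  qed
  define S where "S = range M \<inter> sphere 0 1"
  define r where "r u = (u \<bullet> H u) / (u \<bullet> M u)" for u
  have "compact S"
    unfolding S_def by (intro closed_Int_compact closed_subspace sub compact_sphere)
  moreover have "S \<noteq> {}"
  proof -
    have "(1 / norm (M u0)) *\<^sub>R M u0 \<in> S"
      using nz subspace_scale[OF sub] by (auto simp: S_def)
    then show ?thesis by blast
  qed
  moreover have "continuous_on S r"
    unfolding r_def
  proof (intro continuous_intros linear_continuous_on_compose[OF _ lin] linear_continuous_on_compose[OF _ linH])
    show "\<forall>u\<in>S. u \<bullet> M u \<noteq> 0"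
      using Mpos by (force simp: S_def)
  qed
  ultimately obtain w where w: "w \<in> S" and max: "\<And>v. v \<in> S \<Longrightarrow> r v \<le> r w"
    using continuous_attains_sup[of S r] by blast
  define c where "c = r w"
  have w_pos: "0 < w \<bullet> M w"
    using w Mpos by (force simp: S_def)
  have onS: "v \<bullet> H v \<le> c * (v \<bullet> M v)" if "v \<in> range M" for v
  proof (cases "v = 0")
    case False
    define n where "n = norm v"
    have n: "n > 0" using False by (simp add: n_def)
    have "(1 / n) *\<^sub>R v \<in> S"
      using False that subspace_scale[OF sub] by (auto simp: S_def n_def)
    then have "r ((1 / n) *\<^sub>R v) \<le> c"
      unfolding c_def by (rule max)
    moreover have "r ((1 / n) *\<^sub>R v) = r v"
      using n by (simp add: r_def linear_cmul[OF lin] linear_cmul[OF linH])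
    ultimately show ?thesis
      using Mpos[OF that False] by (simp add: r_def pos_divide_le_eq)
  qed (simp add: linear_0[OF linH])
  \<comment> \<open>The component orthogonal to the range lies in the kernel of \<open>M\<close>,
    hence in that of \<open>H\<close> by \<open>ker\<close>, and contributes to neither
    form.\<close>
  have all: "v \<bullet> H v \<le> c * (v \<bullet> M v)" for v
  proof -
    obtain y z where y: "y \<in> span (range M)" and z: "\<And>w. w \<in> span (range M) \<Longrightarrow> orthogonal z w"
      and v: "v = y + z"
      using orthogonal_subspace_decomp_exists[of "range M" v] by blast
    have "orthogonal z (M (M z))"
      by (intro z span_base) simp
    then have Mz: "M z = 0"
      using sa[of z "M z"] by (simp add: orthogonal_def)
    then have Hz: "H z = 0" by (rule ker)
    have "v \<bullet> H v = y \<bullet> H y" "v \<bullet> M v = y \<bullet> M y"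
      using Mz Hz sa[of z y] saH[of z y]
      by (auto simp: v linear_add[OF lin] linear_add[OF linH] inner_add_left inner_add_right)
    moreover have "y \<in> range M"
      using y sub by (simp add: span_eq_iff[THEN iffD2])
    ultimately show ?thesis using onS by simp
  qed
  \<comment> \<open>By the bound just proved \<open>c M - H\<close> is semidefinite, and its form
    vanishes at \<open>w\<close>; \<open>psd_form_zero\<close> turns this into the eigenvector
    equation.\<close>
  have psdN: "psd (\<lambda>v. c *\<^sub>R M v - H v)"
    unfolding psd_def selfadjoint_def
    using all sa saH lin linH
    by (auto simp: inner_diff_left inner_diff_right intro!: linear_compose_sub linear_compose_scale_right)
  have "w \<bullet> (c *\<^sub>R M w - H w) = 0"
    using w_pos by (simp add: c_def r_def inner_diff_right)
  then have Hw: "H w = c *\<^sub>R M w"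
    using psd_form_zero[OF psdN] by force
  define k where "k = 1 / sqrt (w \<bullet> M w)"
  have "(k *\<^sub>R w) \<bullet> M (k *\<^sub>R w) = 1"
    using w_pos by (simp add: k_def linear_cmul[OF lin])
  moreover have "H (k *\<^sub>R w) = c *\<^sub>R M (k *\<^sub>R w)"
    using Hw by (simp add: linear_cmul[OF lin] linear_cmul[OF linH])
  ultimately show ?thesis
    using all by (rule that)
qed

section \<open>Harmonic decomposition of lossless operators\<close>

text \<open>For \<open>Z\<close> a sum of rank-one terms z z^T this is the sum of the values
  \<beta>(z, z), the trace pairing of the form with \<open>Z\<close>.\<close>

definition trace_form :: "('a \<Rightarrow> 'a \<Rightarrow> real) \<Rightarrow> ('a::euclidean_space \<Rightarrow> 'a) \<Rightarrow> real" where
  "trace_form \<beta> Z = (\<Sum>b\<in>Basis. \<beta> b (Z b))"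

text \<open>For symmetric \<open>Z\<close> this subtracts the rank-one map (Z u)(Z u)^T. When
  \<open>u \<bullet> Z u = 1\<close> it is a Schur complement step, which puts \<open>u\<close> into
  the kernel.\<close>

definition deflate :: "('a::euclidean_space \<Rightarrow> 'a) \<Rightarrow> 'a \<Rightarrow> 'a \<Rightarrow> 'a" where
  "deflate Z u q = Z q - (u \<bullet> Z q) *\<^sub>R Z u"

lemma psd_linear: "psd Z \<Longrightarrow> linear Z"
  by (simp add: psd_def selfadjoint_def)

lemma psd_sym: "psd Z \<Longrightarrow> Z u \<bullet> v = u \<bullet> Z v"
  by (simp add: psd_def selfadjoint_def)

lemma psd_nonneg: "psd Z \<Longrightarrow> 0 \<le> u \<bullet> Z u"
  by (simp add: psd_def)

lemma psd_normalize:
  assumes Z: "psd Z" and "Z u \<noteq> 0"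
  obtains k where "k > 0" "(k *\<^sub>R u) \<bullet> Z (k *\<^sub>R u) = 1"
proof -
  have "0 < u \<bullet> Z u"
    using psd_form_zero[OF Z, of u] psd_nonneg[OF Z, of u] assms(2) by fastforce
  then show ?thesis
    by (intro that[of "1 / sqrt (u \<bullet> Z u)"]) (simp_all add: linear_cmul[OF psd_linear[OF Z]])
qed

text \<open>The form of the deflated map at \<open>q\<close> is the form of \<open>Z\<close> at
  \<open>q - (u \<bullet> Z q) u\<close>.\<close>

lemma psd_deflate:
  assumes Z: "psd Z" and u: "u \<bullet> Z u = 1"
  shows "psd (deflate Z u)"
proof -
  note lin = psd_linear[OF Z] and sa = psd_sym[OF Z]
  have "linear (deflate Z u)"
    by (rule linearI) (simp_all add: deflate_def linear_add[OF lin] linear_cmul[OF lin] algebra_simps)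
  moreover have "deflate Z u p \<bullet> q = p \<bullet> deflate Z u q" for p q
    using sa[of p q] sa[of u p] sa[of u q] sa[of p u] sa[of q u]
    by (simp add: deflate_def algebra_simps inner_commute)
  moreover have "0 \<le> q \<bullet> deflate Z u q" for q
  proof -
    define t where "t = u \<bullet> Z q"
    have "0 \<le> (q - t *\<^sub>R u) \<bullet> Z (q - t *\<^sub>R u)"
      by (rule psd_nonneg[OF Z])
    also have "\<dots> = q \<bullet> deflate Z u q"
      using u sa[of q u]
      by (simp add: deflate_def linear_diff[OF lin] linear_cmul[OF lin] algebra_simps
          t_def[symmetric] inner_commute)
    finally show ?thesis .
  qed
  ultimately show ?thesis
    by (simp add: psd_def selfadjoint_def)
qed

lemma trace_deflate:
  assumes Z: "psd Z" and \<beta>: "bilinear \<beta>"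
  shows "trace_form \<beta> Z = trace_form \<beta> (deflate Z u) + \<beta> (Z u) (Z u)"
proof -
  have linl: "linear (\<lambda>x. \<beta> x y)" and linr: "linear (\<beta> x)" for x y
    using \<beta> by (simp_all add: bilinear_def)
  have "\<beta> (Z u) (Z u) = \<beta> (\<Sum>b\<in>Basis. (Z u \<bullet> b) *\<^sub>R b) (Z u)"
    by (simp add: euclidean_representation)
  also have "\<dots> = (\<Sum>b\<in>Basis. (u \<bullet> Z b) * \<beta> b (Z u))"
    by (simp add: linear_sum[OF linl] linear_cmul[OF linl] psd_sym[OF Z])
  finally show ?thesis
    by (simp add: trace_form_def deflate_def linear_diff[OF linr] linear_cmul[OF linr] sum_subtractf)
qed

lemma deflate_eq_0: "Z q = 0 \<Longrightarrow> deflate Z u q = 0"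
  by (simp add: deflate_def)

lemma deflate_self: "u \<bullet> Z u = 1 \<Longrightarrow> deflate Z u u = 0"
  by (simp add: deflate_def)

text \<open>Skewness of the state block of \<open>f Z\<close>, stated through its quadratic form.
  For semidefinite \<open>Z\<close> it makes the term x \<bullet> X f(z) have trace zero against
  \<open>Z\<close> for every symmetric \<open>X\<close>.\<close>

definition lossless :: "('a::euclidean_space \<times> 'b::euclidean_space \<Rightarrow> 'a) \<Rightarrow> ('a \<times> 'b \<Rightarrow> 'a \<times> 'b) \<Rightarrow> bool"
  where "lossless f Z \<longleftrightarrow> (\<forall>p. p \<bullet> f (Z (p, 0)) = 0)"

text \<open>A complex vector is represented by its real and imaginary parts \<open>z1\<close> and \<open>z2\<close>, so the two
  equations say that \<open>f z = i \<omega> fst z\<close>. Inputs with zero state are the case \<open>\<omega> = \<infinity>\<close>.\<close>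

definition freq_negative ::
  "('a::euclidean_space \<times> 'b::euclidean_space \<Rightarrow> 'a) \<Rightarrow> ('a \<times> 'b \<Rightarrow> 'a \<times> 'b \<Rightarrow> real) \<Rightarrow> bool" where
  "freq_negative f \<beta> \<longleftrightarrow> (\<forall>w. w \<noteq> 0 \<longrightarrow> \<beta> (0, w) (0, w) < 0) \<and>
    (\<forall>\<omega> z1 z2. f z1 = - \<omega> *\<^sub>R fst z2 \<longrightarrow> f z2 = \<omega> *\<^sub>R fst z1 \<longrightarrow> (z1, z2) \<noteq> (0, 0) \<longrightarrow>
       \<beta> z1 z1 + \<beta> z2 z2 < 0)"

text \<open>What is split off is either a harmonic response of \<open>f\<close> or an input with
  zero state. By \<open>neg\<close> it has negative trace, so the remainder has larger trace than
  \<open>Z\<close>.\<close>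

lemma deflation_step:
  fixes f :: "'a::euclidean_space \<times> 'b::euclidean_space \<Rightarrow> 'a"
  assumes f: "linear f" and \<beta>: "bilinear \<beta>" and neg: "freq_negative f \<beta>"
    and Z: "psd Z" and loss: "lossless f Z" and nz: "Z u0 \<noteq> 0"
  obtains Z' u where "psd Z'" "lossless f Z'" "\<And>q. Z q = 0 \<Longrightarrow> Z' q = 0" "Z u \<noteq> 0" "Z' u = 0"
    "trace_form \<beta> Z < trace_form \<beta> Z'"
proof -
  note lin = psd_linear[OF Z] and sa = psd_sym[OF Z]
  define M where "M p = fst (Z (p, 0))" for p
  define S where "S p = f (Z (p, 0))" for p
  have linp: "linear (\<lambda>p::'a. (p, 0::'b))"
    by (rule linearI) auto
  have linM: "linear M" and linS: "linear S"
    unfolding M_def S_def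
    using linear_compose[OF linp lin] linear_compose[OF _ f] linear_compose[OF _ linear_fst]
    by (auto simp: o_def)
  have M_inner: "(p, 0) \<bullet> Z (r, 0) = p \<bullet> M r" for p r
    by (simp add: M_def inner_prod_def)
  have saM: "M p \<bullet> r = p \<bullet> M r" for p r
    using sa[of "(p, 0)" "(r, 0)"] by (simp add: M_inner inner_commute[of "Z _"] inner_commute[of "M _"])
  \<comment> \<open>Since the kernel of the state block \<open>M\<close> is annihilated by
    \<open>Z\<close>, it is also annihilated by \<open>S\<close>, as
    \<open>generalized_eigenvector\<close> will require.\<close>
  have M0: "Z (p, 0) = 0" if "M p = 0" for p
    using psd_form_zero[OF Z, of "(p, 0)"] that by (simp add: M_inner)
  have Mnn: "0 \<le> p \<bullet> M p" for p
    using psd_nonneg[OF Z, of "(p, 0)"] by (simp add: M_inner)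
  have S0: "p \<bullet> S p = 0" for p
    using loss by (simp add: S_def lossless_def)
  have skew: "S p \<bullet> r = - (p \<bullet> S r)" for p r
    using S0[of "p + r"] S0[of p] S0[of r]
    by (simp add: linear_add[OF linS] inner_add_left inner_add_right inner_commute)
  show ?thesis
  proof (cases "\<exists>p. M p \<noteq> 0")
    case True
    then obtain p0 where p0: "M p0 \<noteq> 0" by blast
    \<comment> \<open>Pairs stand for complex vectors p + i r. On them \<open>HH\<close> is -i times
      the skew map \<open>S\<close>, hence selfadjoint, and its eigenvalue \<open>c\<close> is a
      frequency.\<close>
    define MM where "MM = (\<lambda>(p, r). (M p, M r))"
    define HH where "HH = (\<lambda>(p, r). (S r, - S p))"
    have "psd MM"
      unfolding psd_def selfadjoint_def
    proof (intro conjI allI)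
      show "linear MM"
        by (rule linearI) (auto simp: MM_def linear_add[OF linM] linear_cmul[OF linM])
    qed (auto simp: MM_def inner_prod_def saM Mnn split: prod.splits)
    moreover have "selfadjoint HH"
      unfolding selfadjoint_def
    proof (intro conjI allI)
      show "linear HH"
        by (rule linearI) (auto simp: HH_def linear_add[OF linS] linear_cmul[OF linS])
    qed (auto simp: HH_def inner_prod_def skew split: prod.splits)
    moreover have "HH u = 0" if "MM u = 0" for u
    proof -
      have "M (fst u) = 0" "M (snd u) = 0"
        using that by (auto simp: MM_def zero_prod_def split: prod.splits)
      then have "S (fst u) = 0" "S (snd u) = 0"
        using M0 linear_0[OF f] by (auto simp: S_def)
      then show ?thesis
        by (auto simp: HH_def zero_prod_def split: prod.splits)
    qed
    moreover have "MM (p0, 0) \<noteq> 0"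
      using p0 by (simp add: MM_def zero_prod_def)
    ultimately obtain c pr where pr: "pr \<bullet> MM pr = 1" "HH pr = c *\<^sub>R MM pr"
      by (rule generalized_eigenvector)
    obtain p r where "pr = (p, r)" by fastforce
    with pr have norm1: "p \<bullet> M p + r \<bullet> M r = 1" and Sr: "S r = c *\<^sub>R M p" and Sp: "- S p = c *\<^sub>R M r"
      by (auto simp: MM_def HH_def inner_prod_def)
    show ?thesis
    proof (cases "c = 0")
      case True
      \<comment> \<open>Frequency zero: \<open>S\<close> kills both \<open>p\<close> and
        \<open>r\<close>, while \<open>norm1\<close> prevents \<open>M\<close> from doing so. A
        single real direction is then removed.\<close>
      have "\<exists>y. M y \<noteq> 0 \<and> S y = 0"
      proof (cases "M p = 0")
        case True
        then have "M r \<noteq> 0" using norm1 by auto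
        with Sr \<open>c = 0\<close> show ?thesis by auto
      next
        case False
        with Sp \<open>c = 0\<close> show ?thesis by auto
      qed
      then obtain y where y: "M y \<noteq> 0" "S y = 0" by blast
      then have "Z (y, 0) \<noteq> 0"
        by (auto simp: M_def)
      then obtain k where k: "k > 0" "(k *\<^sub>R (y, 0)) \<bullet> Z (k *\<^sub>R (y, 0::'b)) = 1"
        using psd_normalize[OF Z] by blast
      define u where "u = k *\<^sub>R (y, 0::'b)"
      have u: "u \<bullet> Z u = 1" using k by (simp add: u_def)
      have fu: "f (Z u) = 0"
        using y by (simp add: u_def linear_cmul[OF lin] linear_cmul[OF f] S_def del: scaleR_Pair)
      have Zu: "Z u \<noteq> 0" using u by auto
      have "\<beta> (Z u) (Z u) + \<beta> 0 0 < 0"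
        using neg fu Zu linear_0[OF f] unfolding freq_negative_def
        by (metis (no_types, lifting) fst_zero prod.inject scale_zero_left scale_zero_right)
      then have "\<beta> (Z u) (Z u) < 0"
        by (simp add: bilinear_lzero[OF \<beta>])
      moreover have "lossless f (deflate Z u)"
        using S0 by (simp add: lossless_def deflate_def linear_diff[OF f] linear_cmul[OF f] fu S_def)
      ultimately show ?thesis
        using that[of "deflate Z u" u] psd_deflate[OF Z u] deflate_eq_0 Zu deflate_self[of u Z, OF u]
          trace_deflate[OF Z \<beta>, of u] by fastforce
    next
      case False
      \<comment> \<open>Skewness of \<open>S\<close> gives \<open>p\<close> and \<open>r\<close>
        equal \<open>M\<close>-lengths and makes them \<open>M\<close>-orthogonal, so the factor
        \<open>sqrt 2\<close> makes \<open>u\<close> and \<open>v\<close> orthonormal for the form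
        of \<open>Z\<close>.\<close>
      have eq1: "p \<bullet> S r = c * (p \<bullet> M p)"
        by (simp add: Sr)
      have "- (r \<bullet> S p) = c * (r \<bullet> M r)"
        by (metis Sp inner_minus_right inner_scaleR_right)
      then have "c * (p \<bullet> M p) = c * (r \<bullet> M r)"
        using eq1 skew[of p r] by (simp add: inner_commute)
      then have half: "p \<bullet> M p = 1 / 2" "r \<bullet> M r = 1 / 2"
        using False norm1 by auto
      have "c * (p \<bullet> M r) = 0"
        by (metis S0 Sp inner_minus_right inner_scaleR_right neg_equal_0_iff_equal)
      then have orth: "p \<bullet> M r = 0"
        using False by simp
      define u where "u = sqrt 2 *\<^sub>R (p, 0::'b)"
      define v where "v = sqrt 2 *\<^sub>R (r, 0::'b)"
      have Zu_eq: "Z u = sqrt 2 *\<^sub>R Z (p, 0)" and Zv_eq: "Z v = sqrt 2 *\<^sub>R Z (r, 0)"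
        by (simp_all add: u_def v_def linear_cmul[OF lin] del: scaleR_Pair)
      have u: "u \<bullet> Z u = 1" and v: "v \<bullet> Z v = 1" and uv: "u \<bullet> Z v = 0"
        unfolding Zu_eq Zv_eq by (simp_all add: u_def v_def M_inner half orth del: scaleR_Pair)
      \<comment> \<open>\<open>Z u\<close> and \<open>Z v\<close> are the real and imaginary parts
        of a response at frequency \<open>c\<close>.\<close>
      have fu: "f (Z u) = - c *\<^sub>R fst (Z v)"
      proof -
        have "S p = - (c *\<^sub>R M r)" using Sp by (metis minus_minus)
        then show ?thesis
          unfolding Zu_eq Zv_eq by (simp add: linear_cmul[OF f] S_def M_def)
      qed
      have fv: "f (Z v) = c *\<^sub>R fst (Z u)"
        unfolding Zu_eq Zv_eq using Sr by (simp add: linear_cmul[OF f] S_def M_def)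
      have Zu: "Z u \<noteq> 0" using u by auto
      define Z1 where "Z1 = deflate Z u"
      have Z1: "psd Z1"
        unfolding Z1_def using Z u by (rule psd_deflate)
      have Z1v: "Z1 v = Z v"
        by (simp add: Z1_def deflate_def uv)
      have v1: "v \<bullet> Z1 v = 1" by (simp add: Z1v v)
      define Z2 where "Z2 = deflate Z1 v"
      have Z2: "psd Z2"
        unfolding Z2_def using Z1 v1 by (rule psd_deflate)
      have "\<beta> (Z u) (Z u) + \<beta> (Z v) (Z v) < 0"
        using neg fu fv Zu unfolding freq_negative_def by blast
      then have "trace_form \<beta> Z < trace_form \<beta> Z2"
        using trace_deflate[OF Z \<beta>, of u] trace_deflate[OF Z1 \<beta>, of v]
        by (simp add: Z1_def[symmetric] Z2_def[symmetric] Z1v)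
      moreover have "Z2 q = 0" if "Z q = 0" for q
        using that by (simp add: Z2_def Z1_def deflate_def)
      moreover have "Z2 u = 0"
        using deflate_self[of u Z, OF u] by (simp add: Z2_def Z1_def deflate_def)
      \<comment> \<open>The two subtracted terms cancel: by \<open>fu\<close> and \<open>fv\<close>
        both are \<open>c\<close> times the product of \<open>fst (Z u) \<bullet> y\<close> and
        \<open>fst (Z v) \<bullet> y\<close>, with opposite signs.\<close>
      moreover have "lossless f Z2"
        unfolding lossless_def
      proof
        fix y
        have "v \<bullet> Z1 (y, 0) = v \<bullet> Z (y, 0)"
          using psd_sym[OF Z1, of v "(y, 0)"] sa[of v "(y, 0)"] by (simp add: Z1v)
        then have "Z2 (y, 0) = Z (y, 0) - (u \<bullet> Z (y, 0)) *\<^sub>R Z u - (v \<bullet> Z (y, 0)) *\<^sub>R Z v"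
          by (simp add: Z2_def deflate_def[of Z1] Z1v) (simp add: Z1_def deflate_def)
        moreover have "w \<bullet> Z (y, 0) = fst (Z w) \<bullet> y" for w
          using sa[of w "(y, 0)"] by (simp add: inner_prod_def)
        ultimately show "y \<bullet> f (Z2 (y, 0)) = 0"
          using S0[of y]
          by (simp add: linear_diff[OF f] linear_cmul[OF f] fu fv inner_diff_right inner_add_right S_def inner_commute)
      qed
      ultimately show ?thesis
        using that Z2 Zu by blast
    qed
  next
    case False
    \<comment> \<open>Without a state block the range of \<open>Z\<close> consists of inputs with
      zero state, for which \<open>freq_negative\<close> has a clause of its own.\<close>
    then have Zp: "Z (p, 0) = 0" for p
      using M0 by blast
    have fst0: "fst (Z q) = 0" for q
    proof -
      have "fst (Z q) \<bullet> p = 0" for p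
        using sa[of q "(p, 0)"] by (simp add: inner_prod_def Zp)
      then show ?thesis
        using inner_eq_zero_iff by blast
    qed
    obtain k where k: "k > 0" "(k *\<^sub>R u0) \<bullet> Z (k *\<^sub>R u0) = 1"
      using psd_normalize[OF Z nz] by blast
    define u where "u = k *\<^sub>R u0"
    have u: "u \<bullet> Z u = 1" using k by (simp add: u_def)
    then have Zu: "Z u \<noteq> 0" by auto
    have "Z u = (0, snd (Z u))"
      using fst0[of u] by (metis prod.collapse)
    then have "\<beta> (Z u) (Z u) < 0"
      using neg Zu unfolding freq_negative_def by (metis zero_prod_def)
    moreover have "lossless f (deflate Z u)"
      by (simp add: lossless_def deflate_def Zp linear_0[OF f])
    ultimately show ?thesis
      using that[of "deflate Z u" u] psd_deflate[OF Z u] deflate_eq_0 Zu deflate_self[of u Z, OF u]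
        trace_deflate[OF Z \<beta>, of u] by fastforce
  qed
qed

text \<open>Induction on the rank of \<open>Z\<close>, written as the codimension of its kernel.
  Each deflation enlarges the kernel and strictly raises the trace, which is 0 once nothing is
  left.\<close>

lemma trace_form_negative:
  fixes f :: "'a::euclidean_space \<times> 'b::euclidean_space \<Rightarrow> 'a"
  assumes f: "linear f" and \<beta>: "bilinear \<beta>" and neg: "freq_negative f \<beta>"
  shows "psd Z \<Longrightarrow> lossless f Z \<Longrightarrow> (\<forall>q. Z q = 0) \<or> trace_form \<beta> Z < 0"
proof (induction "DIM('a \<times> 'b) - dim {q. Z q = 0}" arbitrary: Z rule: less_induct)
  case less
  show ?case
  proof (cases "\<forall>q. Z q = 0")
    case False
    then obtain u0 where "Z u0 \<noteq> 0" by blast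
    then obtain Z' u where Z': "psd Z'" "lossless f Z'" "\<And>q. Z q = 0 \<Longrightarrow> Z' q = 0"
      and u: "Z u \<noteq> 0" "Z' u = 0" and lt: "trace_form \<beta> Z < trace_form \<beta> Z'"
      using deflation_step[OF f \<beta> neg less.prems] by blast
    have "subspace {q. Z q = 0}" "subspace {q. Z' q = 0}"
      using less.prems Z' by (auto intro!: linear_subspace_kernel psd_linear)
    moreover have "{q. Z q = 0} \<subset> {q. Z' q = 0}"
      using Z' u by blast
    ultimately have "dim {q. Z q = 0} < dim {q. Z' q = 0}"
      by (metis dim_psubset span_eq_iff)
    moreover have "dim {q. Z' q = 0} \<le> DIM('a \<times> 'b)"
      by (rule dim_subset_UNIV)
    ultimately have "(\<forall>q. Z' q = 0) \<or> trace_form \<beta> Z' < 0"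
      by (intro less.hyps Z') linarith
    moreover have "trace_form \<beta> Z' = 0" if "\<forall>q. Z' q = 0"
      using that unfolding trace_form_def by (intro sum.neutral ballI) (metis bilinear_rzero[OF \<beta>])
    ultimately show ?thesis
      using lt by fastforce
  qed simp
qed

section \<open>The Kalman--Yakubovich--Popov lemma\<close>

text \<open>The matrix x y^T + y x^T. Pairing with it expresses the storage term as a linear
  functional of the unknown \<open>X\<close>, as hyperplane separation needs.\<close>

definition sym_outer :: "real^'n \<Rightarrow> real^'n \<Rightarrow> real^'n^'n" where
  "sym_outer x y = (\<chi> i j. x $ i * y $ j + y $ i * x $ j)"

lemma inner_sym_outer: "X \<bullet> sym_outer x y = x \<bullet> (X *v y) + y \<bullet> (X *v x)"
  by (simp add: inner_vec_def sym_outer_def matrix_vector_mult_def sum_distrib_left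
      sum.distrib algebra_simps)

lemma sym_outer_scaleR: "sym_outer (k *\<^sub>R x) (k *\<^sub>R y) = k\<^sup>2 *\<^sub>R sym_outer x y"
  by (simp add: sym_outer_def vec_eq_iff power2_eq_square algebra_simps)

text \<open>The weighted points define the semidefinite map \<open>Z\<close>, the sum of u z z^T.
  The hypothesis \<open>sum0\<close> makes it lossless and the sum to be bounded is its trace, so
  \<open>trace_form_negative\<close> applies.\<close>

lemma lossless_negative:
  fixes f :: "(real^'n) \<times> 'b::euclidean_space \<Rightarrow> real^'n" and z :: "'i \<Rightarrow> (real^'n) \<times> 'b"
  assumes f: "linear f" and \<beta>: "bilinear \<beta>" and neg: "freq_negative f \<beta>"
    and S: "finite S" "\<And>s. s \<in> S \<Longrightarrow> 0 \<le> u s" and s0: "s0 \<in> S" "u s0 > 0" "z s0 \<noteq> 0"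
    and sum0: "(\<Sum>s\<in>S. u s *\<^sub>R sym_outer (fst (z s)) (f (z s))) = 0"
  shows "(\<Sum>s\<in>S. u s * \<beta> (z s) (z s)) < 0"
proof -
  have linl: "linear (\<lambda>x. \<beta> x y)" and linr: "linear (\<beta> x)" for x y
    using \<beta> unfolding bilinear_def by blast+
  define Z where "Z q = (\<Sum>s\<in>S. (u s * (z s \<bullet> q)) *\<^sub>R z s)" for q
  have ZZ: "q \<bullet> Z q = (\<Sum>s\<in>S. u s * (z s \<bullet> q)\<^sup>2)" for q
    by (simp add: Z_def inner_sum_right power2_eq_square inner_commute algebra_simps)
  have "psd Z"
    unfolding psd_def selfadjoint_def
  proof (intro conjI allI)
    show "linear Z"
      by (rule linearI)
        (simp_all add: Z_def inner_add_right algebra_simps sum.distrib scaleR_sum_right)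
    show "Z p \<bullet> q = p \<bullet> Z q" for p q
      unfolding Z_def inner_sum_right inner_sum_left by (intro sum.cong) (simp_all add: inner_commute)
    show "0 \<le> q \<bullet> Z q" for q
      unfolding ZZ using S by (intro sum_nonneg) auto
  qed
  moreover have "lossless f Z"
    unfolding lossless_def
  proof
    fix p :: "real^'n"
    \<comment> \<open>Testing \<open>sum0\<close> against the rank-one matrix p p^T isolates the
      quadratic form at \<open>p\<close>.\<close>
    define X :: "real^'n^'n"  where "X = (\<chi> i j. p $ i * p $ j)"
    have X: "X *v y = (p \<bullet> y) *\<^sub>R p" for y
      by (simp add: X_def vec_eq_iff matrix_vector_mult_def inner_vec_def sum_distrib_right sum_distrib_left algebra_simps)
    have "0 = X \<bullet> (\<Sum>s\<in>S. u s *\<^sub>R sym_outer (fst (z s)) (f (z s)))"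
      by (simp add: sum0)
    also have "\<dots> = 2 * (\<Sum>s\<in>S. u s * (fst (z s) \<bullet> p) * (p \<bullet> f (z s)))"
      by (simp add: inner_sum_right inner_sym_outer X sum_distrib_left inner_commute algebra_simps)
    also have "(\<Sum>s\<in>S. u s * (fst (z s) \<bullet> p) * (p \<bullet> f (z s))) = p \<bullet> f (Z (p, 0))"
      by (simp add: Z_def linear_sum[OF f] linear_cmul[OF f] inner_sum_right inner_prod_def)
    finally show "p \<bullet> f (Z (p, 0)) = 0" by simp
  qed
  moreover have "Z (z s0) \<noteq> 0"
  proof -
    have "0 < u s0 * (z s0 \<bullet> z s0)\<^sup>2"
      using s0 by simp
    also have "\<dots> \<le> z s0 \<bullet> Z (z s0)"
      unfolding ZZ using S s0 by (intro member_le_sum) auto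
    finally show ?thesis by auto
  qed
  ultimately have "trace_form \<beta> Z < 0"
    using trace_form_negative[OF f \<beta> neg] by blast
  also have "trace_form \<beta> Z = (\<Sum>b\<in>Basis. \<Sum>s\<in>S. u s * ((z s \<bullet> b) * \<beta> b (z s)))"
    by (simp add: trace_form_def Z_def linear_sum[OF linr] linear_cmul[OF linr] mult.assoc)
  also have "\<dots> = (\<Sum>s\<in>S. u s * (\<Sum>b\<in>Basis. (z s \<bullet> b) * \<beta> b (z s)))"
    by (subst sum.swap) (simp add: sum_distrib_left)
  also have "\<dots> = (\<Sum>s\<in>S. u s * \<beta> (\<Sum>b\<in>Basis. (z s \<bullet> b) *\<^sub>R b) (z s))"
    by (simp add: linear_sum[OF linl] linear_cmul[OF linl])
  finally show ?thesis
    by (simp add: euclidean_representation)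
qed

text \<open>A suitable \<open>X\<close> is a linear functional negative on all
  \<open>\<phi> z\<close>, with positive weight on the second coordinate. It comes from separating
  the compact convex hull \<open>K\<close> from the ray \<open>T\<close>; a common point would
  contradict \<open>lossless_negative\<close>.\<close>

theorem kyp_lemma:
  fixes f :: "(real^'n) \<times> 'b::euclidean_space \<Rightarrow> real^'n"
  assumes f: "linear f" and \<beta>: "bilinear \<beta>" and neg: "freq_negative f \<beta>"
  obtains X where "transpose X = X" "\<And>z. z \<noteq> 0 \<Longrightarrow> 2 * (fst z \<bullet> (X *v f z)) + \<beta> z z < 0"
proof -
  have linl: "linear (\<lambda>x. \<beta> x y)" and linr: "linear (\<beta> x)" for x y
    using \<beta> unfolding bilinear_def by blast+
  define \<phi> where "\<phi> z = (sym_outer (fst z) (f z), \<beta> z z)" for z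
  define K where "K = convex hull (\<phi> ` sphere 0 1)"
  define T :: "((real^'n^'n) \<times> real) set" where "T = {0} \<times> {0..}"
  obtain b0 :: 'b where b0: "b0 \<in> Basis" using nonempty_Basis by blast
  have e0: "(0, b0) \<in> sphere 0 1"
    using b0 by (simp add: dist_prod_def)
  have "continuous_on (sphere 0 1) \<phi>"
    unfolding \<phi>_def sym_outer_def
    using bilinear_continuous_on_compose[OF continuous_on_id continuous_on_id \<beta>, of "sphere 0 1"]
    by (intro continuous_on_Pair continuous_on_vec_lambda continuous_intros linear_continuous_on_compose[OF _ f]) auto
  then have "compact K"
    unfolding K_def by (intro compact_convex_hull compact_continuous_image compact_sphere)
  moreover have "K \<noteq> {}"
    using e0 by (auto simp: K_def)
  moreover have "convex K"
    by (simp add: K_def)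
  moreover have "convex T" "closed T"
    by (auto simp: T_def intro!: convex_Times closed_Times)
  moreover have "K \<inter> T = {}"
  proof (rule ccontr)
    assume "K \<inter> T \<noteq> {}"
    then obtain t where t: "t \<ge> 0" and "(0, t) \<in> convex hull (\<phi> ` sphere 0 1)"
      by (auto simp: K_def T_def)
    then obtain S u where S: "finite S" "S \<subseteq> \<phi> ` sphere 0 1" "\<forall>x\<in>S. 0 \<le> u x" "sum u S = 1"
      and eq: "(\<Sum>v\<in>S. u v *\<^sub>R v) = (0, t)"
      unfolding convex_hull_explicit by blast
    obtain z where z: "\<And>s. s \<in> S \<Longrightarrow> norm (z s) = 1 \<and> \<phi> (z s) = s"
    proof -
      have "\<forall>s\<in>S. \<exists>x. norm x = 1 \<and> \<phi> x = s"
        using S(2) by fastforce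
      then show ?thesis
        using that by metis
    qed
    have "\<exists>s0\<in>S. u s0 > 0"
    proof (rule ccontr)
      assume "\<not> ?thesis"
      then have "sum u S \<le> 0" by (intro sum_nonpos) force
      with S show False by simp
    qed
    then obtain s0 where s0: "s0 \<in> S" "u s0 > 0" by blast
    have eq': "(0, t) = (\<Sum>s\<in>S. u s *\<^sub>R \<phi> (z s))"
      using z by (simp add: eq[symmetric])
    have "(\<Sum>s\<in>S. u s *\<^sub>R sym_outer (fst (z s)) (f (z s))) = 0"
      using arg_cong[OF eq', of fst] by (simp add: fst_sum \<phi>_def)
    moreover have "(\<Sum>s\<in>S. u s * \<beta> (z s) (z s)) = t"
      using arg_cong[OF eq', of snd] by (simp add: snd_sum \<phi>_def)
    moreover have "z s0 \<noteq> 0"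
      using z[OF s0(1)] by auto
    ultimately show False
      using lossless_negative[OF f \<beta> neg, of S u s0 z] S s0 t by auto
  qed
  ultimately obtain a b where ab: "\<And>k. k \<in> K \<Longrightarrow> a \<bullet> k < b" "\<And>k. k \<in> T \<Longrightarrow> a \<bullet> k > b"
    using separating_hyperplane_compact_closed by metis
  obtain X c where a: "a = (X, c)" by fastforce
  have b: "b < 0"
    using ab(2)[of "(0, 0)"] by (simp add: T_def a)
  \<comment> \<open>Otherwise \<open>T\<close> would contain \<open>(0, b / c)\<close>, where the
    functional equals \<open>b\<close>.\<close>
  have "c \<ge> 0"
  proof (rule ccontr)
    assume "\<not> c \<ge> 0"
    then have "(0, b / c) \<in> T"
      using b by (simp add: T_def divide_nonpos_neg)
    then show False
      using ab(2) \<open>\<not> c \<ge> 0\<close> by (fastforce simp: a)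
  qed
  have sph: "X \<bullet> sym_outer (fst z) (f z) + c * \<beta> z z < 0" if "norm z = 1" for z
  proof -
    have "\<phi> z \<in> K"
      using that hull_subset[of "\<phi> ` sphere 0 1" convex] by (auto simp: K_def)
    then show ?thesis
      using ab(1) b by (fastforce simp: a \<phi>_def)
  qed
  \<comment> \<open>At an input with zero state the matrix coordinate of \<open>\<phi>\<close> is
    zero, so with \<open>c = 0\<close> the functional would vanish there.\<close>
  have "c \<noteq> 0"
    using sph[of "(0, b0)"] b0 by (auto simp: inner_sym_outer)
  with \<open>c \<ge> 0\<close> have c: "c > 0" by simp
  \<comment> \<open>Pairing with \<open>sym_outer\<close> sees only the symmetric part of
    \<open>X\<close>; dividing by \<open>c\<close> gives the form weight one.\<close>
  define X' where "X' = (1 / (2 * c)) *\<^sub>R (X + transpose X)"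
  have "transpose X' = X'"
    by (simp add: X'_def transpose_def vec_eq_iff)
  moreover have "2 * (fst z \<bullet> (X' *v f z)) + \<beta> z z < 0" if "z \<noteq> 0" for z
  proof -
    define n where "n = norm z"
    have n: "n > 0" using that by (simp add: n_def)
    define y where "y = (1 / n) *\<^sub>R z"
    have z: "z = n *\<^sub>R y" using n by (simp add: y_def)
    have "norm y = 1" using n by (simp add: y_def n_def)
    have "2 * c * (fst z \<bullet> (X' *v f z)) = X \<bullet> sym_outer (fst z) (f z)"
      using c by (simp add: X'_def inner_sym_outer scaleR_matrix_vector_assoc[symmetric]
        matrix_vector_mult_add_rdistrib inner_add_right)
        (metis dot_lmul_matrix inner_commute)
    then have "c * (2 * (fst z \<bullet> (X' *v f z)) + \<beta> z z) = X \<bullet> sym_outer (fst z) (f z) + c * \<beta> z z"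
      by (simp add: algebra_simps)
    also have "\<dots> = n\<^sup>2 * (X \<bullet> sym_outer (fst y) (f y) + c * \<beta> y y)"
      by (simp add: z linear_cmul[OF f] linear_cmul[OF linl] linear_cmul[OF linr] sym_outer_scaleR
          power2_eq_square algebra_simps)
    also have "\<dots> < 0"
      using sph[OF \<open>norm y = 1\<close>] n by (simp add: mult_pos_neg)
    finally show ?thesis
      using c by (simp add: mult_less_0_iff)
  qed
  ultimately show ?thesis
    by (rule that)
qed

lemma mat_vector_mult: "mat k *v v = k *s (v :: 'a::semiring_1^'n)"
  by (simp add: mat_def matrix_vector_mult_def vec_eq_iff if_distrib[where f = "\<lambda>x. x * _"] cong: if_cong)

lemma mat_vector_mult_real: "mat s *v x = s *\<^sub>R (x :: real^'n)"
  by (simp add: mat_vector_mult scalar_mult_eq_scaleR)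

text \<open>The maximum over the compact unit sphere is negative, and homogeneity spreads it to all
  vectors.\<close>

lemma quadratic_negative_margin:
  fixes q :: "'a::euclidean_space \<Rightarrow> real"
  assumes cont: "continuous_on UNIV q" and hom: "\<And>k z. q (k *\<^sub>R z) = k\<^sup>2 * q z"
    and neg: "\<And>z. z \<noteq> 0 \<Longrightarrow> q z < 0"
  obtains \<mu> where "\<mu> > 0" "\<And>z. q z \<le> - \<mu> * (norm z)\<^sup>2"
proof -
  obtain b :: 'a where "b \<in> Basis" using nonempty_Basis by blast
  then have ne: "sphere (0::'a) 1 \<noteq> {}" by force
  have "continuous_on (sphere 0 1) q"
    using cont continuous_on_subset by blast
  then obtain w where w: "w \<in> sphere 0 1" "\<And>v. v \<in> sphere 0 1 \<Longrightarrow> q v \<le> q w"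
    using continuous_attains_sup[OF compact_sphere ne] by blast
  have "q z \<le> - (- q w) * (norm z)\<^sup>2" for z
  proof (cases "z = 0")
    case True
    then show ?thesis using hom[of 0 z] by simp
  next
    case False
    have "q z = (norm z)\<^sup>2 * q ((1 / norm z) *\<^sub>R z)"
      using False hom[of "norm z" "(1 / norm z) *\<^sub>R z"] by simp
    also have "\<dots> \<le> (norm z)\<^sup>2 * q w"
      using False by (intro mult_left_mono w(2)) auto
    finally show ?thesis by (simp add: mult.commute)
  qed
  moreover have "- q w > 0"
    using w neg[of w] by force
  ultimately show ?thesis
    using that by blast
qed

section \<open>Complex vectors and Hurwitz matrices\<close>

definition re_vec :: "complex^'n \<Rightarrow> real^'n" where "re_vec v = (\<chi> i. Re (v $ i))"
definition im_vec :: "complex^'n \<Rightarrow> real^'n" where "im_vec v = (\<chi> i. Im (v $ i))"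
definition cvec :: "real^'n \<Rightarrow> real^'n \<Rightarrow> complex^'n" where "cvec a b = (\<chi> i. Complex (a $ i) (b $ i))"

lemma re_im_cvec [simp]: "re_vec (cvec a b) = a" "im_vec (cvec a b) = b" "cvec (re_vec v) (im_vec v) = v"
  by (simp_all add: re_vec_def im_vec_def cvec_def vec_eq_iff)

lemma cvec_eq_iff: "cvec a b = cvec c d \<longleftrightarrow> a = c \<and> b = d"
  by (metis re_im_cvec(1,2))

lemma cvec_eq_0_iff: "cvec a b = 0 \<longleftrightarrow> a = 0 \<and> b = 0"
  by (auto simp: cvec_def vec_eq_iff complex_eq_iff)

lemma cvec_add: "cvec a b + cvec c d = cvec (a + c) (b + d)"
  by (simp add: cvec_def vec_eq_iff complex_eq_iff)

lemma cvec_scale: "l *s cvec a b = cvec (Re l *\<^sub>R a - Im l *\<^sub>R b) (Im l *\<^sub>R a + Re l *\<^sub>R b)"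
  by (simp add: cvec_def vec_eq_iff complex_eq_iff)

lemma cmat_cvec: "cmat M *v cvec a b = cvec (M *v a) (M *v b)"
  by (simp add: cvec_def vec_eq_iff complex_eq_iff matrix_vector_mult_def)

lemma norm_cvec: "(norm (cvec a b))\<^sup>2 = (norm a)\<^sup>2 + (norm b)\<^sup>2"
  by (simp add: power2_norm_eq_inner inner_vec_def cvec_def inner_complex_def sum.distrib)

lemma eigenvalue_cmat_iff:
  "eigenvalue (cmat F) l \<longleftrightarrow> (\<exists>a b. (a, b) \<noteq> (0, 0) \<and>
     F *v a = Re l *\<^sub>R a - Im l *\<^sub>R b \<and> F *v b = Im l *\<^sub>R a + Re l *\<^sub>R b)"
proof -
  have "eigenvalue (cmat F) l \<longleftrightarrow> (\<exists>a b. cvec a b \<noteq> 0 \<and> cmat F *v cvec a b = l *s cvec a b)"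
    unfolding eigenvalue_def by (metis re_im_cvec(3))
  then show ?thesis
    by (simp add: cmat_cvec cvec_scale cvec_eq_iff cvec_eq_0_iff)
qed

lemma hurwitz_no_eigenvector:
  assumes "hurwitz F" "F *v a = s *\<^sub>R a - \<omega> *\<^sub>R b" "F *v b = \<omega> *\<^sub>R a + s *\<^sub>R b" "s \<ge> 0"
  shows "a = 0 \<and> b = 0"
  using assms unfolding hurwitz_def eigenvalue_cmat_iff
  by (metis complex.sel linorder_not_less prod.inject)

section \<open>Lyapunov inequalities and the definiteness of their solutions\<close>

lemma inner_matrix_sym: "transpose X = X \<Longrightarrow> (X *v a) \<bullet> b = a \<bullet> (X *v (b::real^'n))"
  by (metis dot_lmul_matrix transpose_matrix_vector)

text \<open>Let \<open>c\<close> be the largest eigenvalue of \<open>- X\<close> relative to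
  \<open>X0\<close>. At its eigenvector the Lyapunov form of \<open>X\<close> is \<open>- c\<close>
  times that of \<open>X0\<close>; both are negative, so \<open>c < 0\<close>, and maximality of
  \<open>c\<close> gives definiteness in all directions.\<close>

lemma lyapunov_pos_def_transfer:
  fixes F X X0 :: "real^'n^'n"
  assumes X0: "pos_def X0" "\<And>x. x \<noteq> 0 \<Longrightarrow> x \<bullet> (X0 *v (F *v x)) < 0"
    and X: "transpose X = X" "\<And>x. x \<noteq> 0 \<Longrightarrow> x \<bullet> (X *v (F *v x)) < 0"
  shows "pos_def X"
proof -
  have s0: "transpose X0 = X0" and p0: "\<And>v. v \<noteq> 0 \<Longrightarrow> 0 < v \<bullet> (X0 *v v)"
    using X0 by (auto simp: pos_def_def)
  have "psd ((*v) X0)"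
    unfolding psd_def selfadjoint_def
    using inner_matrix_sym[OF s0] p0 by (metis inner_zero_left matrix_vector_mul_linear order_less_imp_le order_refl)
  moreover have "selfadjoint (\<lambda>v. - (X *v v))"
    unfolding selfadjoint_def
    by (auto simp: inner_matrix_sym[OF X(1)] intro!: linear_compose_neg)
  moreover have "- (X *v v) = 0" if "X0 *v v = 0" for v
  proof -
    have "v = 0" using p0[of v] that by force
    then show ?thesis by simp
  qed
  moreover have "X0 *v 1 \<noteq> 0"
    using p0[of 1] by (force simp: vec_eq_iff)
  ultimately obtain c u where u: "u \<bullet> (X0 *v u) = 1" "- (X *v u) = c *\<^sub>R (X0 *v u)"
    and le: "\<And>v. v \<bullet> - (X *v v) \<le> c * (v \<bullet> (X0 *v v))"
    by (rule generalized_eigenvector) (assumption, rule that)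
  have "u \<noteq> 0" using u by auto
  have "u \<bullet> (X *v (F *v u)) = - (c * (u \<bullet> (X0 *v (F *v u))))"
  proof -
    have "X *v u = - (c *\<^sub>R (X0 *v u))" using u(2) by (metis minus_minus)
    then have "(X *v u) \<bullet> (F *v u) = - (c * ((X0 *v u) \<bullet> (F *v u)))" by simp
    then show ?thesis by (simp add: inner_matrix_sym X(1) s0)
  qed
  then have "c * (u \<bullet> (X0 *v (F *v u))) > 0"
    using X(2)[OF \<open>u \<noteq> 0\<close>] by simp
  then have c: "c < 0"
    using X0(2)[OF \<open>u \<noteq> 0\<close>] by (simp add: zero_less_mult_iff)
  have "0 < v \<bullet> (X *v v)" if "v \<noteq> 0" for v
    using le[of v] mult_neg_pos[OF c p0[OF that]] by simp
  then show ?thesis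
    using X(1) by (simp add: pos_def_def)
qed

text \<open>The case of \<open>kyp_lemma\<close> with a dummy scalar input that does not act on the
  state. Its frequency condition says that \<open>F\<close> has no eigenvalue with real part
  \<open>s\<close>. Definiteness of \<open>X\<close> is a separate matter.\<close>

lemma shifted_lyapunov_solution:
  fixes F :: "real^'n^'n"
  assumes F: "hurwitz F" and s: "s \<ge> 0"
  obtains X where "transpose X = X" "\<And>x. x \<noteq> 0 \<Longrightarrow> x \<bullet> (X *v ((F - mat s) *v x)) < 0"
proof -
  define f :: "(real^'n) \<times> real \<Rightarrow> real^'n" where "f z = (F - mat s) *v fst z" for z
  define \<beta> :: "(real^'n) \<times> real \<Rightarrow> (real^'n) \<times> real \<Rightarrow> real" where "\<beta> y z = - (snd y * snd z)" for y z
  have "linear f"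
    by (rule linearI) (simp_all add: f_def matrix_vector_right_distrib matrix_vector_mult_scaleR)
  moreover have "bilinear \<beta>"
    unfolding bilinear_def \<beta>_def by (auto intro!: linearI simp: algebra_simps)
  moreover have "freq_negative f \<beta>"
    unfolding freq_negative_def
  proof (intro conjI allI impI)
    fix \<omega> z1 z2
    assume 1: "f z1 = - \<omega> *\<^sub>R fst z2" "f z2 = \<omega> *\<^sub>R fst z1" and nz: "(z1, z2) \<noteq> (0, 0)"
    have "F *v fst z1 = s *\<^sub>R fst z1 - \<omega> *\<^sub>R fst z2" "F *v fst z2 = \<omega> *\<^sub>R fst z1 + s *\<^sub>R fst z2"
      using 1 by (simp_all add: f_def matrix_vector_mult_diff_rdistrib mat_vector_mult_real algebra_simps)
    then have "fst z1 = 0 \<and> fst z2 = 0"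
      using hurwitz_no_eigenvector[OF F] s by blast
    then have "snd z1 \<noteq> 0 \<or> snd z2 \<noteq> 0"
      using nz by (auto simp: prod_eq_iff)
    then have "0 < snd z1 * snd z1 + snd z2 * snd z2"
      by (simp add: sum_squares_gt_zero_iff)
    then show "\<beta> z1 z1 + \<beta> z2 z2 < 0"
      by (simp add: \<beta>_def)
  next
    fix w :: real assume "w \<noteq> 0"
    then have "0 < w * w" by (auto simp: zero_less_mult_iff)
    then show "\<beta> (0, w) (0, w) < 0" by (simp add: \<beta>_def)
  qed
  ultimately obtain X where X: "transpose X = X" "\<And>z. z \<noteq> 0 \<Longrightarrow> 2 * (fst z \<bullet> (X *v f z)) + \<beta> z z < 0"
    by (rule kyp_lemma) blast
  show ?thesis
  proof (rule that[OF X(1)])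
    fix x :: "real^'n" assume "x \<noteq> 0"
    then show "x \<bullet> (X *v ((F - mat s) *v x)) < 0"
      using X(2)[of "(x, 0)"] by (simp add: f_def \<beta>_def zero_prod_def)
  qed
qed

text \<open>The shifts \<open>F - s I\<close> join \<open>F\<close> to a matrix for which the identity is a Lyapunov matrix, and
  definiteness of the solutions is locally constant in \<open>s\<close>.\<close>

lemma lyapunov_pos_def:
  fixes F X :: "real^'n^'n"
  assumes F: "hurwitz F" and X: "transpose X = X" "\<And>x. x \<noteq> 0 \<Longrightarrow> x \<bullet> (X *v (F *v x)) < 0"
  shows "pos_def X"
proof -
  define Lyap where "Lyap s Y \<longleftrightarrow> transpose Y = Y \<and> (\<forall>x. x \<noteq> 0 \<longrightarrow> x \<bullet> (Y *v ((F - mat s) *v x)) < 0)"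
    for s and Y :: "real^'n^'n"
  \<comment> \<open>By the transfer lemma one definite solution makes all solutions definite, so
    \<open>Q s\<close> may be checked on any single one.\<close>
  define Q where "Q s \<longleftrightarrow> (\<forall>Y. Lyap s Y \<longrightarrow> pos_def Y)" for s
  have Q_iff: "Q s" if "Lyap s Y" "pos_def Y" for s Y
    using that lyapunov_pos_def_transfer[of Y "F - mat s"] unfolding Q_def Lyap_def by blast
  have bound: "\<exists>K>0. \<forall>x. \<bar>x \<bullet> (Y *v x)\<bar> \<le> K * (norm x)\<^sup>2" for Y :: "real^'n^'n"
  proof -
    obtain K where K: "K > 0" "\<And>x. norm (Y *v x) \<le> K * norm x"
      using linear_bounded_pos[OF matrix_vector_mul_linear[of Y]] by metis
    have "\<bar>x \<bullet> (Y *v x)\<bar> \<le> K * (norm x)\<^sup>2" for x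
    proof -
      have "\<bar>x \<bullet> (Y *v x)\<bar> \<le> norm x * norm (Y *v x)"
        by (rule Cauchy_Schwarz_ineq2)
      also have "\<dots> \<le> norm x * (K * norm x)"
        by (intro mult_left_mono K) simp
      finally show ?thesis by (simp add: power2_eq_square algebra_simps)
    qed
    with K show ?thesis by blast
  qed
  obtain K where K: "K > 0" "\<And>x. \<bar>x \<bullet> (F *v x)\<bar> \<le> K * (norm x)\<^sup>2"
    using bound[of F] by blast
  \<comment> \<open>Exceeds the bound \<open>K\<close> on the quadratic form of \<open>F\<close>, so
    the identity is a Lyapunov matrix for the shifted \<open>F\<close>.\<close>
  define s0 where "s0 = K + 1"
  have "Lyap s0 (mat 1)"
    unfolding Lyap_def
  proof (intro conjI allI impI)
    fix x :: "real^'n" assume "x \<noteq> 0"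
    then have "0 < x \<bullet> x" by simp
    then show "x \<bullet> (mat 1 *v ((F - mat s0) *v x)) < 0"
      using K(2)[of x] by (simp add: matrix_vector_mult_diff_rdistrib mat_vector_mult_real abs_le_iff
          inner_diff_right s0_def power2_norm_eq_inner algebra_simps del: inner_gt_zero_iff)
  qed simp
  moreover have "pos_def (mat 1 :: real^'n^'n)"
    by (simp add: pos_def_def)
  ultimately have "Q s0" by (rule Q_iff)
  have "Q 0"
  proof (rule connected_induction_simple[where S = "{0..s0}" and a = s0 and P = Q])
    fix a assume a: "a \<in> {0..s0}"
    obtain Y where Y: "Lyap a Y"
      using shifted_lyapunov_solution[OF F, of a] a unfolding Lyap_def by (metis atLeastAtMost_iff)
    obtain \<mu> where \<mu>: "\<mu> > 0" "\<And>x. x \<bullet> (Y *v ((F - mat a) *v x)) \<le> - \<mu> * (norm x)\<^sup>2"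
    proof (rule quadratic_negative_margin[of "\<lambda>x. x \<bullet> (Y *v ((F - mat a) *v x))"])
      show "continuous_on UNIV (\<lambda>x. x \<bullet> (Y *v ((F - mat a) *v x)))"
        by (intro continuous_intros matrix_vector_mult_linear_continuous_on
            linear_continuous_on_compose[OF _ matrix_vector_mul_linear])
      show "(k *\<^sub>R z) \<bullet> (Y *v ((F - mat a) *v (k *\<^sub>R z))) = k\<^sup>2 * (z \<bullet> (Y *v ((F - mat a) *v z)))" for k z
        by (simp add: matrix_vector_mult_scaleR power2_eq_square)
    qed (use Y in \<open>auto simp: Lyap_def\<close>)
    obtain L where L: "L > 0" "\<And>x. \<bar>x \<bullet> (Y *v x)\<bar> \<le> L * (norm x)\<^sup>2"
      using bound[of Y] by blast
    \<comment> \<open>Moving the shift from \<open>a\<close> to \<open>s\<close> changes the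
      Lyapunov form of \<open>Y\<close> by at most \<open>|a - s| L |x|^2\<close>, so within this
      radius the margin \<open>\<mu>\<close> keeps \<open>Y\<close> a solution.\<close>
    define T where "T = {0..s0} \<inter> ball a (\<mu> / L)"
    have LyapT: "Lyap s Y" if "s \<in> T" for s
      unfolding Lyap_def
    proof (intro conjI allI impI)
      show "transpose Y = Y" using Y by (simp add: Lyap_def)
      fix x :: "real^'n" assume x: "x \<noteq> 0"
      have "\<bar>a - s\<bar> * L < \<mu>"
        using that L by (simp add: T_def dist_real_def pos_less_divide_eq)
      have "x \<bullet> (Y *v ((F - mat s) *v x)) = x \<bullet> (Y *v ((F - mat a) *v x)) + (a - s) * (x \<bullet> (Y *v x))"
        by (simp add: matrix_vector_mult_diff_rdistrib mat_vector_mult_real matrix_vector_mult_diff_distrib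
            inner_diff_right matrix_vector_mult_scaleR algebra_simps)
      also have "\<dots> \<le> - \<mu> * (norm x)\<^sup>2 + \<bar>a - s\<bar> * (L * (norm x)\<^sup>2)"
      proof (intro add_mono \<mu>)
        have "(a - s) * (x \<bullet> (Y *v x)) \<le> \<bar>a - s\<bar> * \<bar>x \<bullet> (Y *v x)\<bar>"
          by (metis abs_ge_self abs_mult)
        also have "\<dots> \<le> \<bar>a - s\<bar> * (L * (norm x)\<^sup>2)"
          by (intro mult_left_mono L) simp
        finally show "(a - s) * (x \<bullet> (Y *v x)) \<le> \<bar>a - s\<bar> * (L * (norm x)\<^sup>2)" .
      qed
      also have "\<dots> = (\<bar>a - s\<bar> * L - \<mu>) * (norm x)\<^sup>2"
        by (simp add: algebra_simps)
      also have "\<dots> < 0"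
        using x \<open>\<bar>a - s\<bar> * L < \<mu>\<close> by (intro mult_neg_pos) auto
      finally show "x \<bullet> (Y *v ((F - mat s) *v x)) < 0" .
    qed
    have "openin (top_of_set {0..s0}) T"
      unfolding T_def by (intro openin_open_Int open_ball)
    moreover have "a \<in> T"
      using a \<mu> L by (simp add: T_def)
    moreover have "Q t" if "s \<in> T" "t \<in> T" "Q s" for s t
      using that LyapT Q_iff unfolding Q_def by blast
    ultimately show "\<exists>T. openin (top_of_set {0..s0}) T \<and> a \<in> T \<and> (\<forall>x\<in>T. \<forall>y\<in>T. Q x \<longrightarrow> Q y)"
      by blast
  qed (use K \<open>Q s0\<close> in \<open>auto simp: s0_def\<close>)
  moreover have "Lyap 0 X"
    using X by (simp add: Lyap_def)
  ultimately show ?thesis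
    by (simp add: Q_def)
qed

section \<open>The largest singular value\<close>

lemma inner_conj_transpose: "(M *v u) \<bullet> v = u \<bullet> (conj_transpose M *v v)"
proof -
  have mult: "(m * a) \<bullet> b = a \<bullet> (cnj m * b)" for m a b :: complex
    by (simp add: inner_complex_def algebra_simps)
  have "(M *v u) \<bullet> v = (\<Sum>i\<in>UNIV. \<Sum>j\<in>UNIV. u $ j \<bullet> (cnj (M $ i $ j) * v $ i))"
    by (simp add: inner_vec_def matrix_vector_mult_def inner_sum_left mult)
  also have "\<dots> = u \<bullet> (conj_transpose M *v v)"
    by (subst sum.swap) (simp add: inner_vec_def matrix_vector_mult_def inner_sum_right
        conj_transpose_def transpose_def)
  finally show ?thesis .
qed

lemma linear_complex_matrix: "linear ((*v) (M :: complex^'n^'m))"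
  by (rule linearI) (simp_all add: matrix_vector_mult_def vec_eq_iff scaleR_sum_right
      distrib_left sum.distrib)

lemma of_real_vector_scale: "complex_of_real c *s v = c *\<^sub>R v"
  by (simp add: vec_eq_iff scaleR_conv_of_real[where 'a = complex])

text \<open>Treating the complex space as a real Euclidean one,
  \<open>generalized_eigenvector\<close> relative to the identity yields the top eigenvalue of
  \<open>conj_transpose M ** M\<close>, with an eigenvector at which the operator norm is
  attained.\<close>

lemma max_singular_value:
  fixes M :: "complex^'n^'m"
  obtains u where "norm u = 1" "norm (M *v u) = max_singular_value M"
    "\<And>v. norm (M *v v) \<le> max_singular_value M * norm v"
proof -
  define H where "H v = conj_transpose M *v (M *v v)" for v
  have MH: "u \<bullet> H v = (M *v u) \<bullet> (M *v v)" for u v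
    by (simp add: H_def inner_conj_transpose)
  have "linear H"
    unfolding H_def using linear_compose[OF linear_complex_matrix[of M] linear_complex_matrix[of "conj_transpose M"]]
    by (simp add: o_def)
  then have sa: "selfadjoint H"
    unfolding selfadjoint_def by (metis MH inner_commute)
  have "psd (\<lambda>v::complex^'n. v)"
    by (simp add: psd_def selfadjoint_def linear_id[unfolded id_def])
  moreover note sa
  moreover have "H u = 0" if "u = 0" for u
    using that by (simp add: H_def)
  moreover have "(1::complex^'n) \<noteq> 0"
    by (simp add: vec_eq_iff)
  ultimately obtain c u where u: "u \<bullet> u = 1" "H u = c *\<^sub>R u" and le: "\<And>v. v \<bullet> H v \<le> c * (v \<bullet> v)"
    by (rule generalized_eigenvector) (assumption, rule that)
  have nMu: "(norm (M *v u))\<^sup>2 = c"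
    using MH[of u u] u by (simp add: power2_norm_eq_inner)
  then have c: "c \<ge> 0" by (metis zero_le_power2)
  have bd: "norm (M *v v) \<le> sqrt c * norm v" for v
  proof (rule power2_le_imp_le)
    show "(norm (M *v v))\<^sup>2 \<le> (sqrt c * norm v)\<^sup>2"
      using le[of v] c by (simp add: MH power2_norm_eq_inner power_mult_distrib)
  qed (use c in auto)
  have eig: "eigenvalue (conj_transpose M ** M) (complex_of_real l) \<longleftrightarrow> (\<exists>v. v \<noteq> 0 \<and> H v = l *\<^sub>R v)" for l
    by (simp add: eigenvalue_def H_def of_real_vector_scale matrix_vector_mul_assoc del: of_real_power)
  have "max_singular_value M = sqrt c"
    unfolding max_singular_value_def
  proof (rule cSup_eq_maximum)
    show "sqrt c \<in> singular_values M"
      unfolding singular_values_def mem_Collect_eq eig using u c by (auto intro!: exI[of _ u])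
  next
    fix \<sigma> assume "\<sigma> \<in> singular_values M"
    then obtain v where \<sigma>: "\<sigma> \<ge> 0" and v: "v \<noteq> 0" "H v = \<sigma>\<^sup>2 *\<^sub>R v"
      unfolding singular_values_def mem_Collect_eq eig by blast
    have "\<sigma>\<^sup>2 * (v \<bullet> v) \<le> c * (v \<bullet> v)"
      using le[of v] v by simp
    then have "\<sigma>\<^sup>2 \<le> c"
      using v by simp
    then show "\<sigma> \<le> sqrt c"
      by (rule real_le_rsqrt)
  qed
  moreover have "norm u = 1"
    using u by (simp add: norm_eq_1)
  moreover have "norm (M *v u) = sqrt c"
    using nMu by (metis norm_ge_zero real_sqrt_unique)
  ultimately show ?thesis
    using that bd by metis
qed

section \<open>The bounded real lemma\<close>

text \<open>For symmetric \<open>X\<close>, the dissipation rate: the derivative of the storage x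
  \<bullet> X x along x' = F x + B w, plus output energy, minus g^2 times input energy.\<close>

definition brl_form ::
  "real^'n^'n \<Rightarrow> real^'m^'n \<Rightarrow> real^'n^'p \<Rightarrow> real^'m^'p \<Rightarrow> real \<Rightarrow> real^'n^'n \<Rightarrow> (real^'n) \<times> (real^'m) \<Rightarrow> real"
where
  "brl_form F B C D g X z = 2 * (fst z \<bullet> (X *v (F *v fst z + B *v snd z))) +
     (norm (C *v fst z + D *v snd z))\<^sup>2 - g\<^sup>2 * (norm (snd z))\<^sup>2"

lemma matrix_inv_works:
  fixes M :: "'a::semiring_1^'n^'m"
  assumes "invertible M"
  shows "M ** matrix_inv M = mat 1" "matrix_inv M ** M = mat 1"
  using someI_ex[OF assms[unfolded invertible_def]] by (auto simp: matrix_inv_def)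

lemma hurwitz_resolvent:
  assumes "hurwitz F" "Re s \<ge> 0"
  shows "invertible (mat s - cmat F)"
proof -
  have "v = 0" if "(mat s - cmat F) *v v = 0" for v
  proof (rule ccontr)
    assume "v \<noteq> 0"
    moreover have "cmat F *v v = s *s v"
      using that by (simp add: matrix_vector_mult_diff_rdistrib mat_vector_mult)
    ultimately show False
      using assms unfolding hurwitz_def eigenvalue_def by fastforce
  qed
  then show ?thesis
    unfolding invertible_left_inverse matrix_left_invertible_ker by blast
qed

text \<open>The hypotheses are the real and imaginary parts of i \<omega> x = F x + B w with x = a +
  i b and w = p + i q.\<close>

lemma transfer_apply:
  assumes "hurwitz F" "F *v a + B *v p = - \<omega> *\<^sub>R b" "F *v b + B *v q = \<omega> *\<^sub>R a"
  shows "transfer F B C D (\<i> * complex_of_real \<omega>) *v cvec p q = cvec (C *v a + D *v p) (C *v b + D *v q)"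
proof -
  let ?N = "mat (\<i> * complex_of_real \<omega>) - cmat F"
  have inv: "invertible ?N"
    using assms(1) by (rule hurwitz_resolvent) simp
  have "?N *v cvec a b = cmat B *v cvec p q"
    using assms(2,3)
    by (simp add: matrix_vector_mult_diff_rdistrib mat_vector_mult cmat_cvec cvec_scale
        diff_eq_eq cvec_add add.commute)
  then have "matrix_inv ?N *v (cmat B *v cvec p q) = (matrix_inv ?N ** ?N) *v cvec a b"
    by (simp add: matrix_vector_mul_assoc[symmetric])
  also have "\<dots> = cvec a b"
    by (simp add: matrix_inv_works(2)[OF inv])
  finally show ?thesis
    by (simp add: transfer_def matrix_vector_mult_add_rdistrib matrix_vector_mul_assoc[symmetric]
        cmat_cvec cvec_add)
qed

lemma frequency_response_exists:
  assumes "hurwitz F"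
  obtains a b where "F *v a + B *v p = - \<omega> *\<^sub>R b" "F *v b + B *v q = \<omega> *\<^sub>R a"
proof -
  let ?N = "mat (\<i> * complex_of_real \<omega>) - cmat F"
  have inv: "invertible ?N"
    using assms by (rule hurwitz_resolvent) simp
  obtain a b where ab: "cvec a b = matrix_inv ?N *v (cmat B *v cvec p q)"
    by (metis re_im_cvec(3))
  have "?N *v cvec a b = (?N ** matrix_inv ?N) *v (cmat B *v cvec p q)"
    by (simp only: ab matrix_vector_mul_assoc matrix_mul_assoc)
  then have "?N *v cvec a b = cmat B *v cvec p q"
    by (simp add: matrix_inv_works(1)[OF inv])
  then have "(\<i> * complex_of_real \<omega>) *s cvec a b = cmat B *v cvec p q + cmat F *v cvec a b"
    by (simp add: matrix_vector_mult_diff_rdistrib mat_vector_mult diff_eq_eq)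
  then have "F *v a + B *v p = - \<omega> *\<^sub>R b \<and> F *v b + B *v q = \<omega> *\<^sub>R a"
    by (simp add: cmat_cvec cvec_scale cvec_add cvec_eq_iff add.commute)
  then show ?thesis
    using that by blast
qed

text \<open>Summed over the real and imaginary parts of a harmonic response, the storage terms
  cancel and only output against input energy remains. Stability comes from the form at zero input,
  evaluated on an eigenvector.\<close>

lemma bounded_real_sufficient:
  fixes F :: "real^'n^'n" and B :: "real^'m^'n" and C :: "real^'n^'p" and D :: "real^'m^'p"
  assumes g: "g > 0" and X: "pos_def X" and neg: "\<And>z. z \<noteq> 0 \<Longrightarrow> brl_form F B C D g X z < 0"
  shows "hinf_bound (<) F B C D g"
proof -
  have symX: "transpose X = X" and posX: "\<And>v. v \<noteq> 0 \<Longrightarrow> 0 < v \<bullet> (X *v v)"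
    using X by (auto simp: pos_def_def)
  have nonneg: "0 \<le> v \<bullet> (X *v v)" for v
    using posX[of v] by (cases "v = 0") auto
  have cross: "b \<bullet> (X *v a) = a \<bullet> (X *v b)" for a b
    by (metis inner_commute inner_matrix_sym symX)
  have hur: "hurwitz F"
    unfolding hurwitz_def
  proof (intro allI impI)
    fix l assume "eigenvalue (cmat F) l"
    then obtain a b where nz: "(a, b) \<noteq> (0, 0)" and a: "F *v a = Re l *\<^sub>R a - Im l *\<^sub>R b"
      and b: "F *v b = Im l *\<^sub>R a + Re l *\<^sub>R b"
      unfolding eigenvalue_cmat_iff by blast
    have form: "2 * (v \<bullet> (X *v (F *v v))) \<le> 0" "v \<noteq> 0 \<Longrightarrow> 2 * (v \<bullet> (X *v (F *v v))) < 0" for v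
    proof -
      show less: "2 * (v \<bullet> (X *v (F *v v))) < 0" if "v \<noteq> 0"
        using neg[of "(v, 0)"] that
        by (simp add: brl_form_def zero_prod_def) (smt (verit) zero_le_power2)
      then show "2 * (v \<bullet> (X *v (F *v v))) \<le> 0"
        by (cases "v = 0") auto
    qed
    have "2 * (a \<bullet> (X *v (F *v a))) + 2 * (b \<bullet> (X *v (F *v b))) < 0"
      using form(1)[of a] form(1)[of b] form(2)[of a] form(2)[of b] nz by force
    also have "2 * (a \<bullet> (X *v (F *v a))) + 2 * (b \<bullet> (X *v (F *v b))) =
        2 * Re l * (a \<bullet> (X *v a) + b \<bullet> (X *v b))"
      by (simp add: a b matrix_vector_right_distrib matrix_vector_mult_diff_distrib
          matrix_vector_mult_scaleR inner_add_right inner_diff_right cross algebra_simps)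
    finally show "Re l < 0"
      using nonneg[of a] nonneg[of b] by (auto simp: mult_less_0_iff)
  qed
  \<comment> \<open>A uniform margin is needed for the supremum over all frequencies to stay
    strictly below \<open>g\<close>.\<close>
  obtain \<mu> where \<mu>: "\<mu> > 0" "\<And>z. brl_form F B C D g X z \<le> - \<mu> * (norm z)\<^sup>2"
  proof (rule quadratic_negative_margin[of "brl_form F B C D g X"])
    show "continuous_on UNIV (brl_form F B C D g X)"
      unfolding brl_form_def
      by (intro continuous_intros linear_continuous_on_compose[OF _ matrix_vector_mul_linear])
    show "brl_form F B C D g X (k *\<^sub>R z) = k\<^sup>2 * brl_form F B C D g X z" for k z
    proof -
      have "F *v fst (k *\<^sub>R z) + B *v snd (k *\<^sub>R z) = k *\<^sub>R (F *v fst z + B *v snd z)"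
        "C *v fst (k *\<^sub>R z) + D *v snd (k *\<^sub>R z) = k *\<^sub>R (C *v fst z + D *v snd z)"
        by (simp_all add: matrix_vector_mult_scaleR scaleR_add_right)
      then have "brl_form F B C D g X (k *\<^sub>R z) = 2 * (k * (k * (fst z \<bullet> (X *v (F *v fst z + B *v snd z))))) +
          k\<^sup>2 * (norm (C *v fst z + D *v snd z))\<^sup>2 - g\<^sup>2 * (k\<^sup>2 * (norm (snd z))\<^sup>2)"
        by (simp only: brl_form_def) (simp add: matrix_vector_mult_scaleR power_mult_distrib)
      then show ?thesis
        by (simp add: brl_form_def right_diff_distrib distrib_left power2_eq_square mult.left_commute mult.assoc)
    qed
  qed (use neg in auto)
  define c where "c = sqrt (g\<^sup>2 - \<mu>)"
  have "c < sqrt (g\<^sup>2)"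
    unfolding c_def using \<mu>(1) by (intro real_sqrt_less_mono) simp
  then have "c < g" using g by simp
  have "max_singular_value (transfer F B C D (\<i> * complex_of_real \<omega>)) \<le> c" for \<omega>
  proof -
    let ?G = "transfer F B C D (\<i> * complex_of_real \<omega>)"
    obtain u where u: "norm u = 1" "norm (?G *v u) = max_singular_value ?G"
      using max_singular_value[of ?G] by blast
    define p q where "p = re_vec u" "q = im_vec u"
    then have upq: "u = cvec p q" by simp
    obtain a b where ab: "F *v a + B *v p = - \<omega> *\<^sub>R b" "F *v b + B *v q = \<omega> *\<^sub>R a"
      using frequency_response_exists[OF hur] by blast
    have "(max_singular_value ?G)\<^sup>2 = (norm (C *v a + D *v p))\<^sup>2 + (norm (C *v b + D *v q))\<^sup>2"
      by (simp add: u(2)[symmetric] upq transfer_apply[OF hur ab] norm_cvec)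
    also have "\<dots> = brl_form F B C D g X (a, p) + brl_form F B C D g X (b, q) +
        g\<^sup>2 * ((norm p)\<^sup>2 + (norm q)\<^sup>2)"
      using ab by (simp add: brl_form_def cross matrix_vector_mult_scaleR algebra_simps
        linear_neg[OF matrix_vector_mul_linear])
    also have "\<dots> \<le> - \<mu> * (norm (a, p))\<^sup>2 - \<mu> * (norm (b, q))\<^sup>2 + g\<^sup>2 * ((norm p)\<^sup>2 + (norm q)\<^sup>2)"
      using \<mu>(2)[of "(a, p)"] \<mu>(2)[of "(b, q)"] by simp
    also have "\<dots> \<le> (g\<^sup>2 - \<mu>) * ((norm p)\<^sup>2 + (norm q)\<^sup>2)"
      using \<mu>(1) by (simp add: norm_prod_def algebra_simps)
    also have "(norm p)\<^sup>2 + (norm q)\<^sup>2 = 1"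
      using u(1) by (simp add: upq norm_cvec[symmetric])
    finally show ?thesis
      unfolding c_def by (intro real_le_rsqrt) simp
  qed
  then have "hinf_norm (transfer F B C D) \<le> ereal c"
    unfolding hinf_norm_def by (intro SUP_least) simp
  also have "\<dots> < ereal g"
    using \<open>c < g\<close> by simp
  finally show ?thesis
    using hur by (simp add: hinf_bound_def)
qed

text \<open>\<open>D\<close> is the limit of the transfer function at high frequency; a finite
  frequency is chosen at which the state adds at most \<open>e\<close> to the output.\<close>

lemma feedthrough_bound:
  fixes F :: "real^'n^'n" and B :: "real^'m^'n" and C :: "real^'n^'p" and D :: "real^'m^'p"
  assumes hur: "hurwitz F"
    and bd: "\<And>\<omega> v. norm (transfer F B C D (\<i> * complex_of_real \<omega>) *v v) \<le> c * norm v"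
  shows "norm (D *v w) \<le> c * norm w"
proof (rule field_le_epsilon)
  fix e :: real assume e: "e > 0"
  obtain K where K: "K > 0" "\<And>x. norm (F *v x) \<le> K * norm x"
    using linear_bounded_pos[OF matrix_vector_mul_linear[of F]] by metis
  obtain L where L: "L > 0" "\<And>x. norm (C *v x) \<le> L * norm x"
    using linear_bounded_pos[OF matrix_vector_mul_linear[of C]] by metis
  \<comment> \<open>Solved from the target \<open>L * norm a \<le> e\<close>; the \<open>+ 1\<close>
    keeps \<open>\<omega>\<close> above \<open>K\<close> even if \<open>B *v w = 0\<close>.\<close>
  define \<omega> where "\<omega> = K + (L * norm (B *v w) + 1) / e"
  have \<omega>: "\<omega> - K > 0" "\<omega> > 0"
    using e K L by (auto simp: \<omega>_def add_nonneg_pos intro!: add_pos_pos divide_pos_pos)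
  obtain a b where ab: "F *v a + B *v w = - \<omega> *\<^sub>R b" "F *v b + B *v 0 = \<omega> *\<^sub>R a"
    using frequency_response_exists[OF hur] by blast
  have "\<omega> * norm b = norm (F *v a + B *v w)"
    using \<omega> by (simp add: ab(1))
  also have "\<dots> \<le> K * norm a + norm (B *v w)"
    using norm_triangle_ineq[of "F *v a" "B *v w"] K(2)[of a] by simp
  finally have 1: "\<omega> * norm b \<le> K * norm a + norm (B *v w)" .
  have "\<omega> * norm a = norm (F *v b)"
    using ab(2) \<omega> by simp
  also have "\<dots> \<le> K * norm b"
    by (rule K)
  finally have "(\<omega> - K) * (norm a + norm b) \<le> norm (B *v w)"
    using 1 by (simp add: algebra_simps)
  moreover have "(\<omega> - K) * norm a \<le> (\<omega> - K) * (norm a + norm b)"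
    using \<omega> by simp
  ultimately have "L * ((\<omega> - K) * norm a) \<le> L * norm (B *v w)"
    using L by (intro mult_left_mono) linarith+
  also have "\<dots> \<le> (\<omega> - K) * e"
    using e by (simp add: \<omega>_def)
  finally have "(\<omega> - K) * (L * norm a) \<le> (\<omega> - K) * e"
    by (simp add: algebra_simps)
  then have small: "L * norm a \<le> e"
    using \<omega> by simp
  have "norm (C *v a + D *v w) \<le> norm (cvec (C *v a + D *v w) (C *v b + D *v 0))"
    by (rule power2_le_imp_le) (simp_all add: norm_cvec)
  also have "\<dots> = norm (transfer F B C D (\<i> * complex_of_real \<omega>) *v cvec w 0)"
    by (simp only: transfer_apply[OF hur ab])
  also have "\<dots> \<le> c * norm (cvec w 0)"
    by (rule bd)
  also have "norm (cvec w 0) = norm w"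
    by (rule power2_eq_imp_eq) (simp_all add: norm_cvec)
  finally have "norm (C *v a + D *v w) \<le> c * norm w" .
  moreover have "norm (D *v w) \<le> norm (C *v a + D *v w) + norm (C *v a)"
    by (metis add_diff_cancel_left' norm_triangle_ineq4)
  ultimately show "norm (D *v w) \<le> c * norm w + e"
    using L(2)[of a] small by linarith
qed

text \<open>The frequency condition of \<open>kyp_lemma\<close> is the norm bound, with
  \<open>feedthrough_bound\<close> covering infinite frequency. At zero input the resulting form
  gives a Lyapunov inequality, so \<open>X\<close> is definite because \<open>F\<close> is
  Hurwitz.\<close>

lemma bounded_real_necessary:
  fixes F :: "real^'n^'n" and B :: "real^'m^'n" and C :: "real^'n^'p" and D :: "real^'m^'p"
  assumes g: "g > 0" and hinf: "hinf_bound (<) F B C D g"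
  obtains X where "pos_def X" "\<And>z. z \<noteq> 0 \<Longrightarrow> brl_form F B C D g X z < 0"
proof -
  have hur: "hurwitz F" and lt: "hinf_norm (transfer F B C D) < ereal g"
    using hinf by (auto simp: hinf_bound_def)
  \<comment> \<open>The limit of infinite frequency preserves only nonstrict bounds, so a constant
    strictly below \<open>g\<close> is fixed first.\<close>
  obtain c where c: "hinf_norm (transfer F B C D) < ereal c" "c < g"
    using ereal_dense2[OF lt] by auto
  have bd: "norm (transfer F B C D (\<i> * complex_of_real \<omega>) *v v) \<le> c * norm v" for \<omega> v
  proof -
    let ?G = "transfer F B C D (\<i> * complex_of_real \<omega>)"
    have "ereal (max_singular_value ?G) \<le> hinf_norm (transfer F B C D)"
      unfolding hinf_norm_def by (rule SUP_upper) simp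
    then have "ereal (max_singular_value ?G) \<le> ereal c"
      using c(1) by (meson le_less_trans less_imp_le)
    then have "max_singular_value ?G \<le> c" by simp
    have "norm (?G *v v) \<le> max_singular_value ?G * norm v"
      using max_singular_value[of ?G] by metis
    also have "\<dots> \<le> c * norm v"
      using \<open>max_singular_value ?G \<le> c\<close> by (intro mult_right_mono) auto
    finally show ?thesis .
  qed
  have "c \<ge> 0"
    using norm_ge_zero[of "transfer F B C D (\<i> * complex_of_real 0) *v 1"] bd[of 0 1]
      zero_less_norm_iff[of "1::complex^'m"] by (smt (verit) mult_neg_pos one_neq_zero one_index vec_eq_iff zero_index)
  then have cg: "c\<^sup>2 < g\<^sup>2"
    using c g by (intro power_strict_mono) auto
  have small: "(norm y)\<^sup>2 - g\<^sup>2 * (norm v)\<^sup>2 < 0" if "norm y \<le> c * norm v" "v \<noteq> 0"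
    for y :: "'u::real_normed_vector" and v :: "'v::real_normed_vector"
  proof -
    have "(norm y)\<^sup>2 \<le> (c * norm v)\<^sup>2"
      using that by (intro power_mono) auto
    also have "\<dots> = c\<^sup>2 * (norm v)\<^sup>2"
      by (simp add: power_mult_distrib)
    also have "\<dots> < g\<^sup>2 * (norm v)\<^sup>2"
      using cg that by (intro mult_strict_right_mono) auto
    finally show ?thesis by simp
  qed
  define f where "f z = F *v fst z + B *v snd z" for z
  define \<beta> where "\<beta> y z = (C *v fst y + D *v snd y) \<bullet> (C *v fst z + D *v snd z) - g\<^sup>2 * (snd y \<bullet> snd z)" for y z
  have lin: "linear f"
    by (rule linearI) (simp_all add: f_def matrix_vector_right_distrib matrix_vector_mult_scaleR algebra_simps)
  have bil: "bilinear \<beta>"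
    unfolding bilinear_def \<beta>_def
    by (auto intro!: linearI simp: matrix_vector_right_distrib matrix_vector_mult_scaleR algebra_simps
        inner_add_left inner_add_right)
  have \<beta>: "\<beta> z z = (norm (C *v fst z + D *v snd z))\<^sup>2 - g\<^sup>2 * (norm (snd z))\<^sup>2" for z
    by (simp add: \<beta>_def power2_norm_eq_inner)
  have freq: "freq_negative f \<beta>"
    unfolding freq_negative_def
  proof (intro conjI allI impI)
    fix w :: "real^'m" assume "w \<noteq> 0"
    then show "\<beta> (0, w) (0, w) < 0"
      using small[OF feedthrough_bound[OF hur bd]] by (simp add: \<beta>)
  next
    fix \<omega> z1 z2 assume 1: "f z1 = - \<omega> *\<^sub>R fst z2" "f z2 = \<omega> *\<^sub>R fst z1" and nz: "(z1, z2) \<noteq> (0, 0)"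
    define v where "v = cvec (snd z1) (snd z2)"
    \<comment> \<open>Without input, the states of \<open>z1\<close> and \<open>z2\<close> would
      form an eigenvector of \<open>F\<close> on the imaginary axis.\<close>
    have "v \<noteq> 0"
    proof
      assume "v = 0"
      then have w: "snd z1 = 0" "snd z2 = 0"
        by (auto simp: v_def cvec_eq_0_iff)
      then have "fst z1 = 0 \<and> fst z2 = 0"
        using 1 hurwitz_no_eigenvector[OF hur, of "fst z1" 0 \<omega> "fst z2"] by (simp add: f_def)
      with w nz show False by (simp add: prod_eq_iff)
    qed
    moreover have "transfer F B C D (\<i> * complex_of_real \<omega>) *v v =
        cvec (C *v fst z1 + D *v snd z1) (C *v fst z2 + D *v snd z2)"
      unfolding v_def using 1 by (intro transfer_apply hur) (simp_all add: f_def)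
    ultimately have "(norm (cvec (C *v fst z1 + D *v snd z1) (C *v fst z2 + D *v snd z2)))\<^sup>2 - g\<^sup>2 * (norm v)\<^sup>2 < 0"
      using small bd by metis
    then show "\<beta> z1 z1 + \<beta> z2 z2 < 0"
      by (simp add: \<beta> v_def norm_cvec algebra_simps)
  qed
  obtain X where X: "transpose X = X" "\<And>z. z \<noteq> 0 \<Longrightarrow> 2 * (fst z \<bullet> (X *v f z)) + \<beta> z z < 0"
    using kyp_lemma[OF lin bil freq] by blast
  have "brl_form F B C D g X z < 0" if "z \<noteq> 0" for z
    using X(2)[OF that] by (simp add: brl_form_def \<beta> f_def)
  moreover have "pos_def X"
  proof (rule lyapunov_pos_def[OF hur X(1)])
    fix x :: "real^'n" assume "x \<noteq> 0"
    then show "x \<bullet> (X *v (F *v x)) < 0"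
      using X(2)[of "(x, 0)"]
      by (simp add: f_def \<beta> zero_prod_def) (smt (verit) zero_le_power2)
  qed
  ultimately show ?thesis
    using that by blast
qed

section \<open>The matrix inequalities as quadratic forms\<close>

definition vjoin :: "'a^'m \<Rightarrow> 'a^'n \<Rightarrow> 'a^('m + 'n)"  (infixr "\<oplus>\<^sub>v" 65) where
  "x \<oplus>\<^sub>v y = (\<chi> i. case i of Inl a \<Rightarrow> x $ a | Inr b \<Rightarrow> y $ b)"

lemma vjoin_nth [simp]: "(x \<oplus>\<^sub>v y) $ Inl i = x $ i" "(x \<oplus>\<^sub>v y) $ Inr j = y $ j"
  by (simp_all add: vjoin_def)

lemma hcat_nth [simp]: "(M ||| N) $ i $ Inl j = M $ i $ j" "(M ||| N) $ i $ Inr k = N $ i $ k"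
  by (simp_all add: hcat_def)

lemma vcat_nth [simp]: "(M \<sslash> N) $ Inl i = M $ i" "(M \<sslash> N) $ Inr k = N $ k"
  by (simp_all add: vcat_def)

lemma forall_sum_index: "(\<forall>i. Q i) \<longleftrightarrow> (\<forall>a. Q (Inl a)) \<and> (\<forall>b. Q (Inr b))"
  by (metis sum.exhaust)

lemma sum_sum_index:
  fixes h :: "'m::finite + 'n::finite \<Rightarrow> 'a::comm_monoid_add"
  shows "(\<Sum>i\<in>UNIV. h i) = (\<Sum>a\<in>UNIV. h (Inl a)) + (\<Sum>b\<in>UNIV. h (Inr b))"
  by (simp add: UNIV_Plus_UNIV[symmetric] sum.Plus del: UNIV_Plus_UNIV)

lemma vjoin_cases:
  obtains x y where "v = x \<oplus>\<^sub>v y"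
proof
  show "v = (\<chi> i. v $ Inl i) \<oplus>\<^sub>v (\<chi> j. v $ Inr j)"
    unfolding vec_eq_iff forall_sum_index by simp
qed

lemma forall_vjoin: "(\<forall>v. Q v) \<longleftrightarrow> (\<forall>x y. Q (x \<oplus>\<^sub>v y))"
  by (metis vjoin_cases)

lemma vjoin_eq_0_iff: "x \<oplus>\<^sub>v y = 0 \<longleftrightarrow> x = 0 \<and> y = 0"
  unfolding vec_eq_iff forall_sum_index by simp

lemma inner_vjoin: "(x \<oplus>\<^sub>v y) \<bullet> (u \<oplus>\<^sub>v v) = x \<bullet> u + y \<bullet> v"
  by (simp add: inner_vec_def sum_sum_index)

lemma norm_vjoin: "(norm ((x :: 'a::real_inner^'m) \<oplus>\<^sub>v y))\<^sup>2 = (norm x)\<^sup>2 + (norm y)\<^sup>2"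
  by (simp add: power2_norm_eq_inner inner_vjoin)

lemma hcat_mult_vjoin: "(M ||| N) *v (x \<oplus>\<^sub>v y) = M *v x + N *v y"
  by (simp add: matrix_vector_mult_def vec_eq_iff sum_sum_index)

lemma vcat_mult: "(M \<sslash> N) *v v = (M *v v) \<oplus>\<^sub>v (N *v v)"
  unfolding vec_eq_iff forall_sum_index by (simp add: matrix_vector_mult_def)

lemma transpose_hcat: "transpose (M ||| N) = transpose M \<sslash> transpose N"
  unfolding vec_eq_iff forall_sum_index by (simp add: transpose_def)

lemma transpose_vcat: "transpose (M \<sslash> N) = transpose M ||| transpose N"
  unfolding vec_eq_iff forall_sum_index by (simp add: transpose_def)

lemma hcat_vcat_interchange: "(M1 \<sslash> M2) ||| (N1 \<sslash> N2) = (M1 ||| N1) \<sslash> (M2 ||| N2)"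
  unfolding vec_eq_iff forall_sum_index by simp

lemma transpose_add: "transpose (M + N) = transpose M + transpose (N :: 'a::semigroup_add^'n^'m)"
  by (simp add: transpose_def vec_eq_iff)

lemma transpose_diff: "transpose (M - N) = transpose M - transpose (N :: 'a::group_add^'n^'m)"
  by (simp add: transpose_def vec_eq_iff)

lemma transpose_uminus: "transpose (- M) = - transpose (M :: 'a::group_add^'n^'m)"
  by (simp add: transpose_def vec_eq_iff)

lemma transpose_0: "transpose 0 = (0 :: 'a::zero^'n^'m)"
  by (simp add: transpose_def vec_eq_iff)

lemma transpose_scaled_diag: "transpose (k *\<^sub>R diag \<beta>) = k *\<^sub>R diag \<beta>"
  by (simp add: transpose_def diag_def vec_eq_iff)

lemma transpose_symmetrize: "transpose (symmetrize M) = symmetrize M"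
  by (simp add: symmetrize_def transpose_add add.commute)

lemma diag_mult_vector: "diag v *v x = (\<chi> i. v $ i * (x $ i :: real))"
  by (simp add: diag_def matrix_vector_mult_def vec_eq_iff if_distrib[where f = "\<lambda>x. x * _"] cong: if_cong)

lemma inner_vector_matrix: "y \<bullet> (x v* A) = (A *v y) \<bullet> (x :: real^'n)"
  by (metis dot_lmul_matrix inner_commute)

lemma neg_def_iff: "neg_def M \<longleftrightarrow> transpose M = M \<and> (\<forall>v. v \<noteq> 0 \<longrightarrow> v \<bullet> (M *v v) < 0)"
proof -
  have "(- M) *v v = - (M *v v)" for v
    by (simp add: matrix_vector_mult_def vec_eq_iff sum_negf)
  then show ?thesis
    by (simp add: neg_def_def pos_def_def transpose_uminus)
qed

text \<open>The blocks built from \<open>C_Delta\<close>, \<open>E_Delta\<close> and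
  \<open>E_d\<close> assemble into one squared output norm.\<close>

lemma LMI_Z_form:
  "(x \<oplus>\<^sub>v a \<oplus>\<^sub>v b) \<bullet> (LMI_Z P X *v (x \<oplus>\<^sub>v a \<oplus>\<^sub>v b)) =
     2 * (x \<bullet> (X *v (A_mat P *v x + B_Delta P *v a + B_d P *v b))) +
     (norm (C_Delta P *v x + E_Delta P *v a + E_d P *v b))\<^sup>2 - (norm a)\<^sup>2 - (norm b)\<^sup>2"
  by (simp add: LMI_Z_def Let_def vcat_mult hcat_mult_vjoin inner_vjoin symmetrize_def
      matrix_vector_mult_add_rdistrib matrix_vector_mult_diff_rdistrib matrix_transpose_mul
      transpose_add matrix_vector_mul_assoc[symmetric] matrix_vector_right_distrib
      inner_add_left inner_add_right inner_diff_right power2_norm_eq_inner inner_vector_matrix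
      dot_lmul_matrix)
    (simp add: inner_commute algebra_simps)

lemma transpose_LMI_Z: "transpose (LMI_Z P X) = LMI_Z P X"
  by (simp add: LMI_Z_def Let_def transpose_vcat transpose_hcat hcat_vcat_interchange
      transpose_add transpose_diff transpose_symmetrize matrix_transpose_mul)

text \<open>Sensor noise has zero columns in this system, so it only adds - |c|^2 to the form, which
  cannot spoil negativity.\<close>

lemma neg_def_LMI_Z_iff:
  "neg_def (LMI_Z P X) \<longleftrightarrow> (\<forall>z. z \<noteq> 0 \<longrightarrow>
     brl_form (A_mat P) (B_Delta P ||| B_d P ||| (0 :: real^'y^'x))
       (C_Delta P) (E_Delta P ||| E_d P ||| (0 :: real^'y^'q)) 1 X z < 0)"
  for P :: "('x::finite, 'w::finite, 'q::finite, 'd::finite, 'y::finite, 'z::finite) plant"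
proof -
  define h where "h x a b = (x \<oplus>\<^sub>v a \<oplus>\<^sub>v b) \<bullet> (LMI_Z P X *v (x \<oplus>\<^sub>v a \<oplus>\<^sub>v b))" for x a b
  have form: "brl_form (A_mat P) (B_Delta P ||| B_d P ||| (0 :: real^'y^'x))
       (C_Delta P) (E_Delta P ||| E_d P ||| (0 :: real^'y^'q)) 1 X (x, a \<oplus>\<^sub>v b \<oplus>\<^sub>v c) =
      h x a b - (norm c)\<^sup>2" for x a b c
    by (simp add: brl_form_def h_def LMI_Z_form hcat_mult_vjoin norm_vjoin algebra_simps)
  have "neg_def (LMI_Z P X) \<longleftrightarrow> (\<forall>x a b. \<not> (x = 0 \<and> a = 0 \<and> b = 0) \<longrightarrow> h x a b < 0)"
    unfolding neg_def_iff transpose_LMI_Z forall_vjoin vjoin_eq_0_iff h_def by simp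
  also have "\<dots> \<longleftrightarrow> (\<forall>x a b (c :: real^'y). \<not> (x = 0 \<and> a = 0 \<and> b = 0 \<and> c = 0) \<longrightarrow> h x a b - (norm c)\<^sup>2 < 0)"
    (is "?L \<longleftrightarrow> ?R")
  proof
    assume L: ?L
    show ?R
    proof (intro allI impI)
      fix x :: "real^'x" and a :: "real^'w" and b :: "real^'d" and c :: "real^'y"
      assume nz: "\<not> (x = 0 \<and> a = 0 \<and> b = 0 \<and> c = 0)"
      show "h x a b - (norm c)\<^sup>2 < 0"
      proof (cases "x = 0 \<and> a = 0 \<and> b = 0")
        case True
        then show ?thesis using nz by (simp add: h_def LMI_Z_form)
      next
        case False
        then have "h x a b < 0" using L by blast
        then show ?thesis by (smt (verit) zero_le_power2)
      qed
    qed
  next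
    assume R: ?R
    show ?L
    proof (intro allI impI)
      fix x :: "real^'x" and a :: "real^'w" and b :: "real^'d" assume "\<not> (x = 0 \<and> a = 0 \<and> b = 0)"
      then have "h x a b - (norm (0 :: real^'y))\<^sup>2 < 0" using R by blast
      then show "h x a b < 0" by simp
    qed
  qed
  also have "\<dots> \<longleftrightarrow> (\<forall>x w. (x, w) \<noteq> 0 \<longrightarrow> brl_form (A_mat P) (B_Delta P ||| B_d P ||| (0 :: real^'y^'x))
       (C_Delta P) (E_Delta P ||| E_d P ||| (0 :: real^'y^'q)) 1 X (x, w) < 0)"
    unfolding forall_vjoin form zero_prod_def prod.inject vjoin_eq_0_iff by simp
  finally show ?thesis
    by (simp only: split_paired_All)
qed

text \<open>Here \<open>c\<close> is the noise after scaling by S_n: it enters the measurement with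
  coefficient one and its energy carries the weight diag(\<beta>). With \<open>X\<close>,
  \<open>Y\<close> and \<open>\<beta>\<close> as separate arguments the expression is affine in
  them.\<close>

definition W_form ::
  "('x::finite, 'w::finite, 'q::finite, 'd::finite, 'y::finite, 'z::finite) plant
     \<Rightarrow> real \<Rightarrow> real^'x^'x \<Rightarrow> real^'y^'x \<Rightarrow> real^'y \<Rightarrow> real^'x \<Rightarrow> real^'w \<Rightarrow> real^'d \<Rightarrow> real^'y \<Rightarrow> real"
where
  "W_form P \<gamma> X Y \<beta> x a b c =
     2 * (x \<bullet> (X *v (A_mat P *v x + B_Delta P *v a + B_d P *v b) +
       Y *v (C_y P *v x + D_Delta P *v a + D_d P *v b + c))) + (norm (C_z P *v x))\<^sup>2 -
     \<gamma>\<^sup>2 * ((norm a)\<^sup>2 + (norm b)\<^sup>2 + c \<bullet> (diag \<beta> *v c))"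

lemma LMI_W_form:
  "(x \<oplus>\<^sub>v a \<oplus>\<^sub>v b \<oplus>\<^sub>v c) \<bullet> (LMI_W P \<gamma> X Y \<beta> *v (x \<oplus>\<^sub>v a \<oplus>\<^sub>v b \<oplus>\<^sub>v c)) = W_form P \<gamma> X Y \<beta> x a b c"
proof -
  have neg: "(- M) *v v = - (M *v v)" for v and M :: "real^'n^'m"
    by (simp add: matrix_vector_mult_def vec_eq_iff sum_negf)
  show ?thesis
    by (simp add: W_form_def LMI_W_def Let_def vcat_mult hcat_mult_vjoin inner_vjoin symmetrize_def
        matrix_vector_mult_add_rdistrib matrix_vector_mult_diff_rdistrib matrix_transpose_mul
        transpose_add matrix_vector_mul_assoc[symmetric] matrix_vector_right_distrib neg mat_vector_mult_real
        scaleR_matrix_vector_assoc[symmetric]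
        inner_add_left inner_add_right inner_diff_right power2_norm_eq_inner inner_vector_matrix
        dot_lmul_matrix)
      (simp add: inner_commute algebra_simps)
qed

lemma transpose_LMI_W: "transpose (LMI_W P \<gamma> X Y \<beta>) = LMI_W P \<gamma> X Y \<beta>"
  by (simp add: LMI_W_def Let_def transpose_vcat transpose_hcat hcat_vcat_interchange
      transpose_add transpose_diff transpose_symmetrize matrix_transpose_mul transpose_0
      transpose_uminus transpose_scaled_diag)

lemma neg_def_LMI_W_iff:
  "neg_def (LMI_W P \<gamma> X Y \<beta>) \<longleftrightarrow>
     (\<forall>x a b c. (x, a, b, c) \<noteq> 0 \<longrightarrow> W_form P \<gamma> X Y \<beta> x a b c < 0)"
  unfolding neg_def_iff transpose_LMI_W forall_vjoin vjoin_eq_0_iff LMI_W_form zero_prod_def by simp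

text \<open>Writing the noise as \<open>diag r *v c\<close> inverts
  \<open>noise_scaling \<beta>\<close>. This bijection turns the scaled error system into the
  variables of \<open>W_form\<close>.\<close>

lemma neg_def_LMI_W_iff_brl:
  assumes \<beta>: "\<forall>i. 0 < \<beta> $ i"
  shows "neg_def (LMI_W P \<gamma> X (X ** L) \<beta>) \<longleftrightarrow>
    (\<forall>z. z \<noteq> 0 \<longrightarrow> brl_form (error_A P L) (error_B P L ** input_scaling \<beta>) (C_z P) 0 \<gamma> X z < 0)"
proof -
  define r where "r = (\<chi> i. sqrt (\<beta> $ i))"
  have r: "r $ i > 0" "r $ i * r $ i = \<beta> $ i" for i
    using \<beta> by (simp_all add: r_def less_imp_le)
  have scal: "noise_scaling \<beta> *v (diag r *v c) = c" for c
    using r by (simp add: noise_scaling_def diag_mult_vector vec_eq_iff r_def less_imp_neq[symmetric])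
  have nrm: "(norm (diag r *v c))\<^sup>2 = c \<bullet> (diag \<beta> *v c)" for c
    by (simp add: power2_norm_eq_inner inner_vec_def diag_mult_vector r(2)[symmetric] mult_ac)
  have surj: "\<exists>c. n = diag r *v c" for n
  proof
    show "n = diag r *v (\<chi> i. n $ i / r $ i)"
      using r(1) by (simp add: diag_mult_vector vec_eq_iff less_imp_neq[symmetric])
  qed
  have zero: "diag r *v c = 0 \<longleftrightarrow> c = 0" for c
    using r(1) by (auto simp: diag_mult_vector vec_eq_iff less_imp_neq[symmetric])
  have form: "brl_form (error_A P L) (error_B P L ** input_scaling \<beta>) (C_z P) 0 \<gamma> X
      (x, a \<oplus>\<^sub>v b \<oplus>\<^sub>v (diag r *v c)) = W_form P \<gamma> X (X ** L) \<beta> x a b c" for x a b c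
    by (simp add: brl_form_def W_form_def error_A_def error_B_def input_scaling_def block_diag_def
        matrix_vector_mul_assoc[symmetric] matrix_vector_mult_add_rdistrib vcat_mult hcat_mult_vjoin
        scal)
      (simp add: norm_vjoin nrm matrix_vector_right_distrib algebra_simps)
  have "(\<forall>x w. (x, w) \<noteq> 0 \<longrightarrow> brl_form (error_A P L) (error_B P L ** input_scaling \<beta>) (C_z P) 0 \<gamma> X (x, w) < 0)
    \<longleftrightarrow> (\<forall>x a b c. (x, a \<oplus>\<^sub>v b \<oplus>\<^sub>v (diag r *v c)) \<noteq> 0 \<longrightarrow>
        brl_form (error_A P L) (error_B P L ** input_scaling \<beta>) (C_z P) 0 \<gamma> X (x, a \<oplus>\<^sub>v b \<oplus>\<^sub>v (diag r *v c)) < 0)"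
    unfolding forall_vjoin using surj by metis
  also have "\<dots> \<longleftrightarrow> (\<forall>x a b c. (x, a, b, c) \<noteq> 0 \<longrightarrow> W_form P \<gamma> X (X ** L) \<beta> x a b c < 0)"
    unfolding form zero_prod_def prod.inject vjoin_eq_0_iff zero ..
  finally show ?thesis
    unfolding neg_def_LMI_W_iff by (simp only: split_paired_All)
qed

section \<open>Designs and matrix inequalities\<close>

lemma pos_def_invertible:
  assumes "pos_def X"
  shows "invertible X"
proof -
  have "v = 0" if "X *v v = 0" for v
    using assms that unfolding pos_def_def by (metis inner_zero_right less_irrefl)
  then show ?thesis
    unfolding invertible_left_inverse matrix_left_invertible_ker by blast
qed

lemma pos_def_combination:
  assumes "pos_def X" "pos_def Y" "s > 0" "t > 0"
  shows "pos_def (s *\<^sub>R X + t *\<^sub>R Y)"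
proof -
  have "0 < s * (v \<bullet> (X *v v)) + t * (v \<bullet> (Y *v v))" if "v \<noteq> 0" for v
    using assms that by (simp add: pos_def_def add_pos_pos)
  then show ?thesis
    using assms
    by (simp add: pos_def_def transpose_add transpose_scalar matrix_vector_mult_add_rdistrib
        scaleR_matrix_vector_assoc[symmetric] inner_add_right)
qed

section \<open>Removing the uncertainty from the design constraints\<close>

lemma hinf_norm_0: "hinf_norm (\<lambda>s. 0 :: complex^'n^'m) \<le> 0"
proof -
  have "max_singular_value (0 :: complex^'n^'m) = 0"
    using max_singular_value[of "0 :: complex^'n^'m"] by (metis matrix_vector_mult_0 norm_zero)
  then show ?thesis
    by (simp add: hinf_norm_def zero_ereal_def)
qed

text \<open>A witness for the quantifier over \<Delta> in \<open>design_feasible\<close>: neither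
  norm bound depends on \<Delta>, so one admissible block suffices to extract them.\<close>

lemma admissible_0: "admissible (\<lambda>s. 0)"
  using hinf_norm_0 order.trans[of _ 0 "1 :: ereal"]
  by (auto simp: admissible_def image_constant_conv intro: order.trans)

lemma design_feasible_iff:
  fixes P :: "('x::finite, 'w::finite, 'q::finite, 'd::finite, 'y::finite, 'z::finite) plant"
  shows "design_feasible R P \<gamma> (L, \<beta>) \<longleftrightarrow> (\<forall>i. 0 < \<beta> $ i) \<and>
     hinf_bound R (error_A P L) (error_B P L ** input_scaling \<beta>) (C_z P) 0 \<gamma> \<and>
     hinf_bound R (A_mat P) (B_Delta P ||| B_d P ||| (0 :: real^'y^'x))
          (C_Delta P) (E_Delta P ||| E_d P ||| (0 :: real^'y^'q)) 1"
  using admissible_0 unfolding design_feasible_def by blast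

lemma hinf_bound_less_imp_le: "hinf_bound (<) F B C D g \<Longrightarrow> hinf_bound (\<le>) F B C D g"
  by (auto simp: hinf_bound_def)

lemma hinf_bound_le_imp_less: "hinf_bound (\<le>) F B C D g \<Longrightarrow> g < g' \<Longrightarrow> hinf_bound (<) F B C D g'"
  by (auto simp: hinf_bound_def intro: le_less_trans)

lemma matrix_inv_mult_cancel:
  fixes X :: "real^'n^'n"
  assumes "invertible X"
  shows "X ** (matrix_inv X ** Y) = Y" "matrix_inv X ** (X ** Y) = Y"
  by (simp_all add: matrix_mul_assoc matrix_inv_works[OF assms])

text \<open>Invertibility of \<open>X2\<close> makes \<open>Y = X2 ** L\<close> a change of
  variables; the bounded real lemma is then used in both directions, with gain \<gamma> for the
  error system and 1 for the plant.\<close>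

lemma strict_design_feasible_iff:
  fixes P :: "('x::finite, 'w::finite, 'q::finite, 'd::finite, 'y::finite, 'z::finite) plant"
  assumes \<gamma>: "\<gamma> > 0"
  shows "design_feasible (<) P \<gamma> (L, \<beta>) \<longleftrightarrow>
    (\<exists>X1 X2 Y. lmi_feasible P \<gamma> (X1, X2, Y, \<beta>) \<and> L = matrix_inv X2 ** Y)"
proof
  assume "design_feasible (<) P \<gamma> (L, \<beta>)"
  then have \<beta>: "\<forall>i. 0 < \<beta> $ i"
    and err: "hinf_bound (<) (error_A P L) (error_B P L ** input_scaling \<beta>) (C_z P) 0 \<gamma>"
    and plant: "hinf_bound (<) (A_mat P) (B_Delta P ||| B_d P ||| (0 :: real^'y^'x))
          (C_Delta P) (E_Delta P ||| E_d P ||| (0 :: real^'y^'q)) 1"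
    unfolding design_feasible_iff by auto
  obtain X1 where X1: "pos_def X1" "neg_def (LMI_Z P X1)"
    using bounded_real_necessary[OF zero_less_one plant] unfolding neg_def_LMI_Z_iff[where 'y = 'y] by blast
  obtain X2 where X2: "pos_def X2" "neg_def (LMI_W P \<gamma> X2 (X2 ** L) \<beta>)"
    using bounded_real_necessary[OF \<gamma> err] unfolding neg_def_LMI_W_iff_brl[OF \<beta>] by blast
  have "lmi_feasible P \<gamma> (X1, X2, X2 ** L, \<beta>) \<and> L = matrix_inv X2 ** (X2 ** L)"
    using X1 X2 \<beta> matrix_inv_mult_cancel(2)[OF pos_def_invertible[OF X2(1)], of L]
    by (simp add: lmi_feasible_def)
  then show "\<exists>X1 X2 Y. lmi_feasible P \<gamma> (X1, X2, Y, \<beta>) \<and> L = matrix_inv X2 ** Y"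
    by blast
next
  assume "\<exists>X1 X2 Y. lmi_feasible P \<gamma> (X1, X2, Y, \<beta>) \<and> L = matrix_inv X2 ** Y"
  then obtain X1 X2 Y where X1: "pos_def X1" "neg_def (LMI_Z P X1)" and X2: "pos_def X2"
    and W: "neg_def (LMI_W P \<gamma> X2 Y \<beta>)" and \<beta>: "\<forall>i. 0 < \<beta> $ i" and L: "L = matrix_inv X2 ** Y"
    by (auto simp: lmi_feasible_def)
  have "Y = X2 ** L"
    using L matrix_inv_mult_cancel(1)[OF pos_def_invertible[OF X2], of Y] by simp
  with W have "neg_def (LMI_W P \<gamma> X2 (X2 ** L) \<beta>)" by simp
  then show "design_feasible (<) P \<gamma> (L, \<beta>)"
    using X1(2) \<beta> unfolding design_feasible_iff neg_def_LMI_Z_iff[where 'y = 'y] neg_def_LMI_W_iff_brl[OF \<beta>]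
    by (auto intro: bounded_real_sufficient[OF \<gamma> X2] bounded_real_sufficient[OF zero_less_one X1(1)])
qed

lemma strict_imp_design_feasible: "design_feasible (<) P \<gamma> u \<Longrightarrow> design_feasible (\<le>) P \<gamma> u"
  by (cases u) (simp add: design_feasible_iff hinf_bound_less_imp_le)

text \<open>The terms without \<open>X\<close>, \<open>Y\<close> or \<open>\<beta>\<close> are
  constant, which is why the weights must sum to one.\<close>

lemma W_form_combination:
  "W_form P \<gamma> (s *\<^sub>R X + t *\<^sub>R X') (s *\<^sub>R Y + t *\<^sub>R Y') (s *\<^sub>R \<beta> + t *\<^sub>R \<beta>') x a b c =
     s * W_form P \<gamma> X Y \<beta> x a b c + t * W_form P \<gamma> X' Y' \<beta>' x a b c"
  if "s + t = 1"
proof -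
  have t: "t = 1 - s" using that by simp
  have diag: "c \<bullet> (diag (s *\<^sub>R \<beta> + t *\<^sub>R \<beta>') *v c) = s * (c \<bullet> (diag \<beta> *v c)) + t * (c \<bullet> (diag \<beta>' *v c))"
    by (simp add: diag_mult_vector inner_vec_def sum_distrib_left sum.distrib[symmetric] algebra_simps)
  show ?thesis
    unfolding W_form_def diag
    by (simp add: matrix_vector_mult_add_rdistrib scaleR_matrix_vector_assoc[symmetric] inner_add_right)
      (simp add: t algebra_simps)
qed

lemma W_form_gain:
  "W_form P \<gamma> X Y \<beta> x a b c =
     W_form P \<gamma>' X Y \<beta> x a b c + (\<gamma>'\<^sup>2 - \<gamma>\<^sup>2) * ((norm a)\<^sup>2 + (norm b)\<^sup>2 + c \<bullet> (diag \<beta> *v c))"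
  by (simp add: W_form_def algebra_simps)

lemma W_form_margin:
  fixes P :: "('x::finite, 'w::finite, 'q::finite, 'd::finite, 'y::finite, 'z::finite) plant"
  assumes "neg_def (LMI_W P \<gamma> X Y \<beta>)"
  obtains \<mu> where "\<mu> > 0"
    "\<And>x a b c. W_form P \<gamma> X Y \<beta> x a b c \<le> - \<mu> * ((norm x)\<^sup>2 + (norm a)\<^sup>2 + (norm b)\<^sup>2 + (norm c)\<^sup>2)"
proof -
  let ?M = "LMI_W P \<gamma> X Y \<beta>"
  have cont: "continuous_on UNIV (\<lambda>v. v \<bullet> (?M *v v))"
    by (intro continuous_intros linear_continuous_on_compose[OF _ matrix_vector_mul_linear])
  have hom: "(k *\<^sub>R v) \<bullet> (?M *v (k *\<^sub>R v)) = k\<^sup>2 * (v \<bullet> (?M *v v))" for k v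
    by (simp add: matrix_vector_mult_scaleR power2_eq_square)
  obtain \<mu> where \<mu>: "\<mu> > 0" "\<And>v. v \<bullet> (?M *v v) \<le> - \<mu> * (norm v)\<^sup>2"
    using quadratic_negative_margin[OF cont hom] assms unfolding neg_def_iff by metis
  show ?thesis
  proof (rule that[OF \<mu>(1)])
    fix x :: "real^'x" and a :: "real^'w" and b :: "real^'d" and c :: "real^'y"
    have "(norm (x \<oplus>\<^sub>v a \<oplus>\<^sub>v b \<oplus>\<^sub>v c))\<^sup>2 = (norm x)\<^sup>2 + (norm a)\<^sup>2 + (norm b)\<^sup>2 + (norm c)\<^sup>2"
      by (simp add: norm_vjoin)
    then show "W_form P \<gamma> X Y \<beta> x a b c \<le> - \<mu> * ((norm x)\<^sup>2 + (norm a)\<^sup>2 + (norm b)\<^sup>2 + (norm c)\<^sup>2)"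
      using \<mu>(2)[of "x \<oplus>\<^sub>v a \<oplus>\<^sub>v b \<oplus>\<^sub>v c"] by (simp add: LMI_W_form)
  qed
qed

text \<open>A feasible design need not be strictly feasible, so it satisfies the matrix inequality only for
  every gain above \<open>\<gamma>\<close>; the margin of the given strict solution absorbs the difference.\<close>

lemma lmi_feasible_interpolation:
  fixes P :: "('x::finite, 'w::finite, 'q::finite, 'd::finite, 'y::finite, 'z::finite) plant"
  assumes \<gamma>: "\<gamma> > 0" and lmi: "lmi_feasible P \<gamma> (X1', X2', Y', \<beta>')"
    and des: "design_feasible (\<le>) P \<gamma> (L, \<beta>)" and t: "0 < t" "t < 1"
  obtains X2 Y where "lmi_feasible P \<gamma> (X1', X2, Y, (1 - t) *\<^sub>R \<beta> + t *\<^sub>R \<beta>')"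
proof -
  have X1': "pos_def X1'" "neg_def (LMI_Z P X1')" and X2': "pos_def X2'"
    and W': "neg_def (LMI_W P \<gamma> X2' Y' \<beta>')" and \<beta>': "\<forall>i. 0 < \<beta>' $ i"
    using lmi by (auto simp: lmi_feasible_def)
  have \<beta>: "\<forall>i. 0 < \<beta> $ i"
    and err: "hinf_bound (\<le>) (error_A P L) (error_B P L ** input_scaling \<beta>) (C_z P) 0 \<gamma>"
    using des unfolding design_feasible_iff by auto
  obtain \<mu> where \<mu>: "\<mu> > 0"
    "\<And>x a b c. W_form P \<gamma> X2' Y' \<beta>' x a b c \<le> - \<mu> * ((norm x)\<^sup>2 + (norm a)\<^sup>2 + (norm b)\<^sup>2 + (norm c)\<^sup>2)"
    using W_form_margin[OF W'] by blast
  \<comment> \<open>Bounds every precision, and is at least 1 so that it also bounds the unit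
    weights of \<open>a\<close> and \<open>b\<close>.\<close>
  define K where "K = 1 + (\<Sum>i\<in>UNIV. \<beta> $ i)"
  have K: "K \<ge> 1" "\<beta> $ i \<le> K" for i
  proof -
    show "K \<ge> 1"
      using \<beta> by (simp add: K_def sum_nonneg less_imp_le)
    have "\<beta> $ i \<le> (\<Sum>i\<in>UNIV. \<beta> $ i)"
      using \<beta> by (intro member_le_sum) (auto simp: less_imp_le)
    then show "\<beta> $ i \<le> K" by (simp add: K_def)
  qed
  have diag_le: "c \<bullet> (diag \<beta> *v c) \<le> K * (norm c)\<^sup>2" for c
  proof -
    have "c \<bullet> (diag \<beta> *v c) = (\<Sum>i\<in>UNIV. \<beta> $ i * (c $ i)\<^sup>2)"
      by (simp add: inner_vec_def diag_mult_vector power2_eq_square mult_ac)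
    also have "\<dots> \<le> (\<Sum>i\<in>UNIV. K * (c $ i)\<^sup>2)"
      using K by (intro sum_mono mult_right_mono) auto
    also have "\<dots> = K * (norm c)\<^sup>2"
      unfolding sum_distrib_left[symmetric] power2_norm_eq_inner[of c]
      by (simp add: inner_vec_def power2_eq_square)
    finally show ?thesis .
  qed
  \<comment> \<open>Chosen so that returning from the gain \<open>\<gamma>'\<close> to
    \<open>\<gamma>\<close> costs at most \<open>t * \<mu> * N\<close>. Weighted by
    \<open>1 - t\<close>, this is outweighed by the margin \<open>t * \<mu> * N\<close> of the
    strict solution.\<close>
  define \<delta> where "\<delta> = t * \<mu> / K"
  have \<delta>: "\<delta> > 0" using t \<mu> K(1) by (simp add: \<delta>_def)
  define \<gamma>' where "\<gamma>' = sqrt (\<gamma>\<^sup>2 + \<delta>)"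
  have sq: "\<gamma>'\<^sup>2 - \<gamma>\<^sup>2 = \<delta>" using \<delta> by (simp add: \<gamma>'_def)
  have "sqrt (\<gamma>\<^sup>2) < \<gamma>'"
    unfolding \<gamma>'_def using \<delta> by (intro real_sqrt_less_mono) simp
  then have lt: "\<gamma> < \<gamma>'" using \<gamma> by simp
  have "\<gamma>' > 0" using \<gamma> lt by simp
  then obtain X where X: "pos_def X" "neg_def (LMI_W P \<gamma>' X (X ** L) \<beta>)"
    using bounded_real_necessary[OF _ hinf_bound_le_imp_less[OF err lt]]
    unfolding neg_def_LMI_W_iff_brl[OF \<beta>] by blast
  have "W_form P \<gamma> ((1 - t) *\<^sub>R X + t *\<^sub>R X2') ((1 - t) *\<^sub>R (X ** L) + t *\<^sub>R Y')
      ((1 - t) *\<^sub>R \<beta> + t *\<^sub>R \<beta>') x a b c < 0" (is "?W < 0")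
    if nz: "(x, a, b, c) \<noteq> 0" for x a b c
  proof -
    define N where "N = (norm x)\<^sup>2 + (norm a)\<^sup>2 + (norm b)\<^sup>2 + (norm c)\<^sup>2"
    have neg: "W_form P \<gamma>' X (X ** L) \<beta> x a b c < 0"
      using X(2) nz unfolding neg_def_LMI_W_iff by blast
    have "(norm a)\<^sup>2 + (norm b)\<^sup>2 + c \<bullet> (diag \<beta> *v c) \<le> K * (norm a)\<^sup>2 + K * (norm b)\<^sup>2 + K * (norm c)\<^sup>2"
      using K(1) diag_le by (intro add_mono mult_right_mono[of 1 K, simplified]) auto
    also have "\<dots> \<le> K * N"
      using K(1) by (simp add: N_def distrib_left)
    finally have "\<delta> * ((norm a)\<^sup>2 + (norm b)\<^sup>2 + c \<bullet> (diag \<beta> *v c)) \<le> \<delta> * (K * N)"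
      using \<delta> by (intro mult_left_mono) auto
    also have "\<dots> = t * \<mu> * N"
      using K(1) by (simp add: \<delta>_def)
    finally have le: "W_form P \<gamma> X (X ** L) \<beta> x a b c \<le> W_form P \<gamma>' X (X ** L) \<beta> x a b c + t * \<mu> * N"
      unfolding W_form_gain[of P \<gamma> X "X ** L" \<beta> x a b c \<gamma>'] sq by simp
    have "?W = (1 - t) * W_form P \<gamma> X (X ** L) \<beta> x a b c + t * W_form P \<gamma> X2' Y' \<beta>' x a b c"
      by (rule W_form_combination) simp
    also have "\<dots> \<le> (1 - t) * (W_form P \<gamma>' X (X ** L) \<beta> x a b c + t * \<mu> * N) + t * (- \<mu> * N)"
      using t le \<mu>(2)[of x a b c] by (intro add_mono mult_left_mono) (auto simp: N_def)
    also have "\<dots> = (1 - t) * W_form P \<gamma>' X (X ** L) \<beta> x a b c - t * t * \<mu> * N"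
      by (simp add: algebra_simps)
    also have "\<dots> < 0"
    proof -
      have "(1 - t) * W_form P \<gamma>' X (X ** L) \<beta> x a b c < 0"
        using neg t by (intro mult_pos_neg) auto
      moreover have "0 \<le> t * t * \<mu> * N"
        using t \<mu>(1) by (simp add: N_def)
      ultimately show ?thesis by linarith
    qed
    finally show ?thesis .
  qed
  then have "neg_def (LMI_W P \<gamma> ((1 - t) *\<^sub>R X + t *\<^sub>R X2') ((1 - t) *\<^sub>R (X ** L) + t *\<^sub>R Y')
      ((1 - t) *\<^sub>R \<beta> + t *\<^sub>R \<beta>'))"
    unfolding neg_def_LMI_W_iff by blast
  moreover have "pos_def ((1 - t) *\<^sub>R X + t *\<^sub>R X2')"
    using X(1) X2' t by (intro pos_def_combination) auto
  moreover have "\<forall>i. 0 < ((1 - t) *\<^sub>R \<beta> + t *\<^sub>R \<beta>') $ i"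
    using \<beta> \<beta>' t by (simp add: add_pos_pos)
  \<comment> \<open>\<open>X1'\<close> is reused, since the plant inequality involves neither the
    gain nor the precisions.\<close>
  ultimately show ?thesis
    using that X1' by (auto simp: lmi_feasible_def)
qed

section \<open>Comparison of the two costs\<close>

lemma weighted_norm1_combination:
  assumes "\<forall>i. 0 < \<beta> $ i" "\<forall>i. 0 < \<beta>' $ i" "0 \<le> s" "0 \<le> t"
  shows "weighted_norm1 \<rho> (s *\<^sub>R \<beta> + t *\<^sub>R \<beta>') = s * weighted_norm1 \<rho> \<beta> + t * weighted_norm1 \<rho> \<beta>'"
proof -
  have "\<bar>s * \<beta> $ i + t * \<beta>' $ i\<bar> = s * \<bar>\<beta> $ i\<bar> + t * \<bar>\<beta>' $ i\<bar>" for i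
    using assms by (simp add: less_imp_le)
  then show ?thesis
    by (simp add: weighted_norm1_def inner_vec_def sum_distrib_left sum.distrib[symmetric] algebra_simps)
qed

lemma weighted_norm1_nonneg: "\<forall>i. \<rho> $ i > 0 \<Longrightarrow> 0 \<le> weighted_norm1 \<rho> \<beta>"
  by (simp add: weighted_norm1_def inner_vec_def sum_nonneg less_imp_le)

text \<open>By interpolation \<open>k\<close> bounds the cost on the open segment of precisions
  between the design and the strict solution. The cost is affine there, so letting \<open>t\<close>
  tend to 0 reaches the design itself.\<close>

lemma design_cost_lower_bound:
  assumes \<gamma>: "\<gamma> > 0" and lmi: "lmi_feasible P \<gamma> v0"
    and low: "\<And>v. lmi_feasible P \<gamma> v \<Longrightarrow> k \<le> lmi_cost \<rho> v"
    and des: "design_feasible (\<le>) P \<gamma> u"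
  shows "k \<le> design_cost \<rho> u"
proof -
  obtain X1 X2 Y \<beta>' where v0: "v0 = (X1, X2, Y, \<beta>')" by (cases v0)
  obtain L \<beta> where u: "u = (L, \<beta>)" by (cases u)
  define h where "h t = (1 - t) * weighted_norm1 \<rho> \<beta> + t * weighted_norm1 \<rho> \<beta>'" for t
  have pos: "\<forall>i. 0 < \<beta> $ i" "\<forall>i. 0 < \<beta>' $ i"
    using des lmi unfolding u v0 design_feasible_iff lmi_feasible_def by auto
  have "k \<le> h t" if t: "0 < t" "t < 1" for t
  proof -
    obtain X2 Y where "lmi_feasible P \<gamma> (X1, X2, Y, (1 - t) *\<^sub>R \<beta> + t *\<^sub>R \<beta>')"
      using lmi_feasible_interpolation[OF \<gamma> lmi[unfolded v0] des[unfolded u] t] by blast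
    from low[OF this] show ?thesis
      using t pos by (simp add: lmi_cost_def h_def weighted_norm1_combination)
  qed
  then have "\<forall>\<^sub>F t in at_right 0. k \<le> h t"
    by (auto simp: eventually_at_right_field intro!: exI[of _ 1])
  moreover have "(h \<longlongrightarrow> h 0) (at_right 0)"
    unfolding h_def by (intro tendsto_intros)
  ultimately have "k \<le> h 0"
    by (intro tendsto_lowerbound[of h _ "at_right 0"]) auto
  then show ?thesis
    by (simp add: h_def u design_cost_def)
qed

text \<open>Strictness of the matrix inequalities keeps their minimum from being attained, so
  optimality is transferred with a tolerance and through the infima.\<close>

theorem theorem7:
  fixes P :: "('x::finite, 'w::finite, 'q::finite, 'd::finite, 'y::finite, 'z::finite) plant"
    and \<gamma> :: real and \<rho> :: "real^'y"
  assumes "\<gamma> > 0" and "\<forall>i. \<rho> $ i > 0"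
  shows
    "(\<forall>X1 X2 Y \<beta>. lmi_feasible P \<gamma> (X1, X2, Y, \<beta>) \<longrightarrow>
        invertible X2 \<and> design_feasible (\<le>) P \<gamma> (matrix_inv X2 ** Y, \<beta>)) \<and>
     (\<forall>X1 X2 Y \<beta> \<epsilon>. 0 \<le> \<epsilon> \<longrightarrow> minimizer_upto \<epsilon> (lmi_cost \<rho>) (lmi_feasible P \<gamma>) (X1, X2, Y, \<beta>) \<longrightarrow>
        minimizer_upto \<epsilon> (design_cost \<rho>) (design_feasible (\<le>) P \<gamma>) (matrix_inv X2 ** Y, \<beta>)) \<and>
     ((\<exists>v. lmi_feasible P \<gamma> v) \<longrightarrow>
        (INF v\<in>{v. lmi_feasible P \<gamma> v}. lmi_cost \<rho> v) =
        (INF u\<in>{u. design_feasible (\<le>) P \<gamma> u}. design_cost \<rho> u)) \<and>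
     (\<forall>L \<beta>. design_feasible (<) P \<gamma> (L, \<beta>) \<longleftrightarrow>
        (\<exists>X1 X2 Y. lmi_feasible P \<gamma> (X1, X2, Y, \<beta>) \<and> L = matrix_inv X2 ** Y))"
proof -
  note \<gamma> = assms(1) and \<rho> = assms(2)
  have feas: "design_feasible (\<le>) P \<gamma> (matrix_inv X2 ** Y, \<beta>)" "invertible X2"
    if "lmi_feasible P \<gamma> (X1, X2, Y, \<beta>)" for X1 X2 Y \<beta>
  proof -
    show "design_feasible (\<le>) P \<gamma> (matrix_inv X2 ** Y, \<beta>)"
      using that strict_design_feasible_iff[OF \<gamma>] by (intro strict_imp_design_feasible) blast
    show "invertible X2"
      using that by (auto simp: lmi_feasible_def intro: pos_def_invertible)
  qed
  have min: "minimizer_upto \<epsilon> (design_cost \<rho>) (design_feasible (\<le>) P \<gamma>) (matrix_inv X2 ** Y, \<beta>)"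
    if "minimizer_upto \<epsilon> (lmi_cost \<rho>) (lmi_feasible P \<gamma>) (X1, X2, Y, \<beta>)" for X1 X2 Y \<beta> \<epsilon>
  proof -
    have lmi: "lmi_feasible P \<gamma> (X1, X2, Y, \<beta>)"
      and opt: "\<And>v. lmi_feasible P \<gamma> v \<Longrightarrow> lmi_cost \<rho> (X1, X2, Y, \<beta>) - \<epsilon> \<le> lmi_cost \<rho> v"
      using that by (auto simp: minimizer_upto_def algebra_simps)
    have "weighted_norm1 \<rho> \<beta> - \<epsilon> \<le> design_cost \<rho> u" if "design_feasible (\<le>) P \<gamma> u" for u
      using design_cost_lower_bound[OF \<gamma> lmi opt that] by (simp add: lmi_cost_def)
    then show ?thesis
      using feas(1)[OF lmi] by (force simp: minimizer_upto_def design_cost_def)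
  qed
  have inf: "(INF v\<in>{v. lmi_feasible P \<gamma> v}. lmi_cost \<rho> v) =
      (INF u\<in>{u. design_feasible (\<le>) P \<gamma> u}. design_cost \<rho> u)" (is "?I = ?J")
    if "lmi_feasible P \<gamma> v0" for v0
  proof (rule antisym)
    \<comment> \<open>Infima of reals need lower bounds; positivity of \<open>\<rho>\<close> makes
      both costs nonnegative.\<close>
    have bdd: "bdd_below (lmi_cost \<rho> ` A)" "bdd_below (design_cost \<rho> ` B)" for A B
      using weighted_norm1_nonneg[OF \<rho>]
      by (auto simp: lmi_cost_def design_cost_def intro!: bdd_belowI2[of _ 0])
    obtain X1 X2 Y \<beta> where v0: "v0 = (X1, X2, Y, \<beta>)" by (cases v0)
    show "?I \<le> ?J"
    proof (rule cINF_greatest)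
      show "{u. design_feasible (\<le>) P \<gamma> u} \<noteq> {}"
        using feas(1) that unfolding v0 by blast
      fix u assume "u \<in> {u. design_feasible (\<le>) P \<gamma> u}"
      then show "?I \<le> design_cost \<rho> u"
        by (intro design_cost_lower_bound[OF \<gamma> that]) (auto intro!: cINF_lower bdd)
    qed
    show "?J \<le> ?I"
    proof (rule cINF_greatest)
      show "{v. lmi_feasible P \<gamma> v} \<noteq> {}"
        using that by blast
      fix v assume v: "v \<in> {v. lmi_feasible P \<gamma> v}"
      obtain X1 X2 Y \<beta> where v_eq: "v = (X1, X2, Y, \<beta>)" by (cases v)
      have "?J \<le> design_cost \<rho> (matrix_inv X2 ** Y, \<beta>)"
        using v feas(1) unfolding v_eq by (intro cINF_lower bdd) blast
      then show "?J \<le> lmi_cost \<rho> v"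
        by (simp add: v_eq design_cost_def lmi_cost_def)
    qed
  qed
  show ?thesis
    using feas min inf strict_design_feasible_iff[OF \<gamma>] by blast
qed

end
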